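(* Let $E=E_1\times E_2$ be a finite-dimensional product cone-space, let $r>0$, and let $A:E\to E$ be a linear map that is $r$-dominating. Then there exists a unique direct sum decomposition $E=F_1\oplus F_2$ into $A$-invariant subspaces $F_1,F_2$ such that $$\sigma(A|_{F_1})\subset\overline{B}(0,\rangle A\langle_r),\qquad \sigma(A|_{F_2})\subset\mathbb{C}\setminus B(0,\langle A\rangle_r).$$ Moreover: 1. $\dim F_1=\dim E_1$ and $\dim F_2=\dim E_2$; 2. $F_1\subset\;\rangle E\langle_r$ and $F_2\subset\langle E\rangle_r$; 3. $\|A|_{F_1}\|\le\;\rangle A\langle_r$ and $\|(A|_{F_2})^{-1}\|\le\langle A\rangle_r^{-1}$, where $\|\cdot\|$ denotes the operator norm induced by $|||\cdot|||_r$ (and $A|_{F_2}:F_2\to F_2$ is invertible).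
   Context: $E_1,E_2$ are finite-dimensional normed spaces over $\mathbb{K}\in\{\mathbb{R},\mathbb{C}\}$. The product cone-space structure on $E=E_1\times E_2$ is given by the semi-norms $\rangle x\langle\;:=\|x_1\|$ and $\langle x\rangle:=\|x_2\|$ for $x=(x_1,x_2)$. For $r>0$ put $|||x|||_r:=\max(\|x_1\|,r\|x_2\|)$ and define the $r$-contracting cone $\rangle E\langle_r:=\{x\in E:\|x_1\|\ge r\|x_2\|\}$ and the $r$-expanding cone $\langle E\rangle_r:=\{x\in E:\|x_1\|\le r\|x_2\|\}$. For a linear map $A:E\to E$ let $$\rangle A\langle_r:=\inf\{R\ge 0: |||Ax|||_r\le R|||x|||_r\text{ for all }x\in E\text{ with }Ax\in\;\rangle E\langle_r\},$$ $$\langle A\rangle_r:=\sup\{R\ge 0: |||Ax|||_r\ge R|||x|||_r\text{ for all }x\in\langle E\rangle_r\}$$ (the supremum being $+\infty$ if unbounded). $A$ is $r$-dominating if $\rangle A\langle_r<\langle A\rangle_r$. $\sigma(\cdot)$ is the set of complex eigenvalues (for $\mathbb{K}=\mathbb{R}$, the eigenvalues of the complexification). $B(0,\rho)=\{z\in\mathbb{C}:|z|<\rho\}$ and $\overline{B}(0,\rho)=\{z\in\mathbb{C}:|z|\le\rho\}$. *)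

theory Defs
  imports "HOL-Analysis.Analysis"
begin

text \<open>
  The scalar field is \<open>\<real>\<close> or \<open>\<complex>\<close>: by lemma \<open>range_to_complex\<close> below, the members of
  this class are, up to isometric isomorphism, exactly these two fields.
\<close>

class real_or_complex = real_normed_field +
  fixes to_complex :: "'a \<Rightarrow> complex"
  assumes to_complex_add: "to_complex (a + b) = to_complex a + to_complex b"
    and to_complex_mult: "to_complex (a * b) = to_complex a * to_complex b"
    and to_complex_scaleR: "to_complex (t *\<^sub>R a) = t *\<^sub>R to_complex a"
    and to_complex_one: "to_complex 1 = 1"
    and norm_to_complex: "cmod (to_complex a) = norm a"

instantiation real :: real_or_complex
begin
definition to_complex_real :: "real \<Rightarrow> complex" where
  "to_complex_real = complex_of_real"
instance
  by standard (simp_all add: to_complex_real_def scaleR_conv_of_real)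
end

instantiation complex :: real_or_complex
begin
definition to_complex_complex :: "complex \<Rightarrow> complex" where
  "to_complex_complex = (\<lambda>z. z)"
instance
  by standard (simp_all add: to_complex_complex_def)
end

lemma to_complex_of_real: "to_complex (of_real t :: 'k::real_or_complex) = of_real t"
  by (simp add: of_real_def to_complex_scaleR to_complex_one)

lemma inj_to_complex: "inj (to_complex :: 'k::real_or_complex \<Rightarrow> complex)"
proof (rule injI)
  fix a b :: 'k
  assume eq: "to_complex a = to_complex b"
  have "to_complex (a - b) + to_complex b = to_complex a"
    by (simp flip: to_complex_add)
  then have "cmod (to_complex (a - b)) = 0"
    using eq by simp
  then show "a = b"
    by (simp add: norm_to_complex)
qed

lemma range_to_complex:
  "range (to_complex :: 'k::real_or_complex \<Rightarrow> complex) = \<real> \<or>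
   range (to_complex :: 'k \<Rightarrow> complex) = UNIV"
proof (cases "range (to_complex :: 'k \<Rightarrow> complex) \<subseteq> \<real>")
  case True
  have "\<real> \<subseteq> range (to_complex :: 'k \<Rightarrow> complex)"
    by (metis Reals_cases rangeI subsetI to_complex_of_real)
  with True show ?thesis by blast
next
  case False
  then obtain k :: 'k where k: "Im (to_complex k) \<noteq> 0"
    by (meson complex_is_Real_iff image_subsetI)
  have "w \<in> range (to_complex :: 'k \<Rightarrow> complex)" for w
  proof -
    define b where "b = Im w / Im (to_complex k)"
    define a where "a = Re w - b * Re (to_complex k)"
    have "to_complex (of_real a + of_real b * k) = of_real a + of_real b * to_complex k"
      by (simp only: to_complex_add to_complex_mult to_complex_of_real)
    also have "\<dots> = w"
      using k by (simp add: complex_eq_iff a_def b_def)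
    finally have "to_complex (of_real a + of_real b * k) = w" .
    then show ?thesis by (metis rangeI)
  qed
  then show ?thesis by blast
qed

text \<open>
  A finite-dimensional normed space over the scalar field is a type of class
  \<open>real_normed_vector\<close>, which supplies the norm and the underlying real structure, together
  with a scalar multiplication by \<open>'k\<close> extending the real one.
\<close>

definition fd_normed_space ::
    "('k::real_or_complex \<Rightarrow> 'v::real_normed_vector \<Rightarrow> 'v) \<Rightarrow> bool" where
  "fd_normed_space s \<longleftrightarrow>
     (\<exists>B. finite_dimensional_vector_space s B) \<and>
     (\<forall>t x. s (of_real t) x = t *\<^sub>R x) \<and>
     (\<forall>c x. norm (s c x) = norm c * norm x)"

definition prod_scale ::
    "('k \<Rightarrow> 'a \<Rightarrow> 'a) \<Rightarrow> ('k \<Rightarrow> 'b \<Rightarrow> 'b) \<Rightarrow> 'k \<Rightarrow> 'a \<times> 'b \<Rightarrow> 'a \<times> 'b" where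
  "prod_scale s1 s2 c x = (s1 c (fst x), s2 c (snd x))"

definition cone_norm :: "real \<Rightarrow> 'a::real_normed_vector \<times> 'b::real_normed_vector \<Rightarrow> real" where
  "cone_norm r x = max (norm (fst x)) (r * norm (snd x))"

definition contracting_cone :: "real \<Rightarrow> ('a::real_normed_vector \<times> 'b::real_normed_vector) set" where
  "contracting_cone r = {x. norm (fst x) \<ge> r * norm (snd x)}"

definition expanding_cone :: "real \<Rightarrow> ('a::real_normed_vector \<times> 'b::real_normed_vector) set" where
  "expanding_cone r = {x. norm (fst x) \<le> r * norm (snd x)}"

text \<open>The rates are extended reals since the expansion rate is \<open>\<infinity>\<close> when \<open>E\<^sub>2 = 0\<close>.\<close>

definition contraction_rate ::
    "real \<Rightarrow> ('a::real_normed_vector \<times> 'b::real_normed_vector \<Rightarrow> 'a \<times> 'b) \<Rightarrow> ereal" where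
  "contraction_rate r A =
     Inf (ereal ` {R. R \<ge> 0 \<and>
       (\<forall>x. A x \<in> contracting_cone r \<longrightarrow> cone_norm r (A x) \<le> R * cone_norm r x)})"

definition expansion_rate ::
    "real \<Rightarrow> ('a::real_normed_vector \<times> 'b::real_normed_vector \<Rightarrow> 'a \<times> 'b) \<Rightarrow> ereal" where
  "expansion_rate r A =
     Sup (ereal ` {R. R \<ge> 0 \<and>
       (\<forall>x\<in>expanding_cone r. cone_norm r (A x) \<ge> R * cone_norm r x)})"

definition dominating ::
    "real \<Rightarrow> ('a::real_normed_vector \<times> 'b::real_normed_vector \<Rightarrow> 'a \<times> 'b) \<Rightarrow> bool" where
  "dominating r A \<longleftrightarrow> contraction_rate r A < expansion_rate r A"

definition eigenvalues_on ::
    "('c \<Rightarrow> 'v::zero \<Rightarrow> 'v) \<Rightarrow> 'v set \<Rightarrow> ('v \<Rightarrow> 'v) \<Rightarrow> 'c set" where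
  "eigenvalues_on s F T = {c. \<exists>v\<in>F. v \<noteq> 0 \<and> T v = s c v}"

text \<open>Multiplication by \<open>z\<close> on the complexification, the pair \<open>(x, y)\<close> standing for \<open>x + i y\<close>.\<close>

definition complexify_scale ::
    "('k::real_or_complex \<Rightarrow> 'v::ab_group_add \<Rightarrow> 'v) \<Rightarrow> complex \<Rightarrow> 'v \<times> 'v \<Rightarrow> 'v \<times> 'v" where
  "complexify_scale s z p =
     (s (of_real (Re z)) (fst p) - s (of_real (Im z)) (snd p),
      s (of_real (Re z)) (snd p) + s (of_real (Im z)) (fst p))"

text \<open>
  The set \<open>\<sigma>(A|F)\<close> for an \<open>A\<close>-invariant subspace \<open>F\<close>; the two cases are the real and the
  complex scalar field. Over the reals, \<open>F \<times> F\<close> and \<open>map_prod A A\<close> are the complexifications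
  of \<open>F\<close> and \<open>A|F\<close>.
\<close>

definition spectrum_on ::
    "('k::real_or_complex \<Rightarrow> 'v::ab_group_add \<Rightarrow> 'v) \<Rightarrow> 'v set \<Rightarrow> ('v \<Rightarrow> 'v) \<Rightarrow> complex set" where
  "spectrum_on s F A =
     (if range (to_complex :: 'k \<Rightarrow> complex) = \<real>
      then eigenvalues_on (complexify_scale s) (F \<times> F) (map_prod A A)
      else to_complex ` eigenvalues_on s F A)"

definition invariant_decomposition ::
    "('k::field \<Rightarrow> 'v::ab_group_add \<Rightarrow> 'v) \<Rightarrow> ('v \<Rightarrow> 'v) \<Rightarrow> 'v set \<Rightarrow> 'v set \<Rightarrow> bool" where
  "invariant_decomposition s A F1 F2 \<longleftrightarrow>
     module.subspace s F1 \<and> module.subspace s F2 \<and>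
     F1 \<inter> F2 = {0} \<and> {x + y | x y. x \<in> F1 \<and> y \<in> F2} = UNIV \<and>
     A ` F1 \<subseteq> F1 \<and> A ` F2 \<subseteq> F2"

definition spectral_decomposition ::
    "('k::real_or_complex \<Rightarrow> 'a::real_normed_vector \<times> 'b::real_normed_vector \<Rightarrow> 'a \<times> 'b) \<Rightarrow>
     real \<Rightarrow> ('a \<times> 'b \<Rightarrow> 'a \<times> 'b) \<Rightarrow> ('a \<times> 'b) set \<Rightarrow> ('a \<times> 'b) set \<Rightarrow> bool" where
  "spectral_decomposition s r A F1 F2 \<longleftrightarrow>
     invariant_decomposition s A F1 F2 \<and>
     spectrum_on s F1 A \<subseteq> {z. ereal (cmod z) \<le> contraction_rate r A} \<and>
     spectrum_on s F2 A \<subseteq> UNIV - {z. ereal (cmod z) < expansion_rate r A}"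

text \<open>
  Operator norm of \<open>T\<close> restricted to the subspace \<open>F\<close>, as \<^const>\<open>onorm\<close> but for the norm
  \<open>cone_norm r\<close>; the term for \<open>x = 0\<close> is \<open>0\<close>.
\<close>

definition cone_onorm_on ::
    "real \<Rightarrow> ('a::real_normed_vector \<times> 'b::real_normed_vector) set \<Rightarrow>
     ('a \<times> 'b \<Rightarrow> 'a \<times> 'b) \<Rightarrow> ereal" where
  "cone_onorm_on r F T = (SUP x\<in>F. ereal (cone_norm r (T x) / cone_norm r x))"

end

(*
  Write l for the contraction rate and choose m with l < m at most the expansion rate. Domination
  forces A to map the expanding cone into itself and its inverse images to preserve the contracting
  cone. Vectors all of whose iterates stay in the contracting cone are those with |||A^n x||| = O(l^n);
  they form a subspace F1. Dually, F2 consists of the x having preimages A^n z = x with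
  |||z||| = O(m^(-n)). The growth bounds alone place F1 and F2 in the two cones. That F1 projects onto
  E1 and F2 onto E2 is a nested compactness argument, the sets being nonempty because
  y |-> snd (A^n (0, y)) is injective, hence onto E2; this gives the dimensions and E = F1 + F2.
  For uniqueness, if x = f1 + f2 lies in an invariant subspace G1 and f2 is nonzero, then A has a
  common eigenvalue on the complexifications of G1 and F2, contradicting the two spectral bounds.
*)

theory Submission
  imports Defs "HOL-Computational_Algebra.Fundamental_Theorem_Algebra"
begin

section \<open>Finite-dimensional normed spaces without a Euclidean structure\<close>

text \<open>The cones are not closed under addition and \<open>A\<close> may have a kernel, so
  neither subspace can be read off from the cones, and \<open>A\<close> cannot be inverted to obtain
  the expanding one. Growth conditions are linear and allow for both, but they hold only up to a
  constant depending on the vector. The sharp estimates return once the subspaces are known to lie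
  in the cones: there the one-step inequalities apply directly, with every rate admissible in the
  definition of the expansion rate and not only with the chosen \<open>m\<close>. This is how an
  auxiliary finite \<open>m\<close> still gives bounds by a possibly infinite rate.

  The dynamics uses only the real structure, and spectra of both scalar fields are compared in the
  complexification of the real space. Over the complex numbers this adds conjugate eigenvalues,
  harmless because only moduli are bounded. The norms are arbitrary, so compactness of bounded
  closed sets is first derived from a finite spanning set.\<close>

lemma infdist_add_scaleR_le:
  fixes b :: "'a::real_normed_vector"
  assumes "subspace V" "y \<in> V"
  shows "\<bar>t\<bar> * infdist b V \<le> norm (y + t *\<^sub>R b)"
proof (cases "t = 0")
  case False
  have "(- inverse t) *\<^sub>R y \<in> V"
    using assms by (rule subspace_mul)
  then have "infdist b V \<le> norm (b - (- inverse t) *\<^sub>R y)"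
    using infdist_le[of _ V b] by (simp only: dist_norm)
  then have "\<bar>t\<bar> * infdist b V \<le> norm (t *\<^sub>R (b - (- inverse t) *\<^sub>R y))"
    by (simp add: mult_left_mono)
  also have "t *\<^sub>R (b - (- inverse t) *\<^sub>R y) = y + t *\<^sub>R b"
    using False by (simp add: algebra_simps)
  finally show ?thesis .
qed simp

text \<open>A convergent sequence is bounded, and a subsequence can only converge to the same limit.
  The hypothesis has the shape of the induction hypothesis in the next lemma, which can thus be
  turned into closedness of the span reached so far.\<close>

lemma closed_if_bounded_subseq:
  fixes V :: "'a::metric_space set"
  assumes "\<And>z::nat \<Rightarrow> 'a. \<lbrakk>\<And>n. z n \<in> V; bounded (range z)\<rbrakk> \<Longrightarrow> \<exists>l\<in>V. \<exists>k. strict_mono k \<and> (z \<circ> k) \<longlonglongrightarrow> l"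
  shows "closed V"
  unfolding closed_sequential_limits
proof (intro allI impI, elim conjE)
  fix z l assume "\<forall>n. z n \<in> V" and "z \<longlonglongrightarrow> l"
  then obtain m k where "m \<in> V" "strict_mono k" "(z \<circ> k) \<longlonglongrightarrow> m"
    using assms[of z] convergent_imp_bounded by blast
  moreover have "(z \<circ> k) \<longlonglongrightarrow> l"
    using \<open>z \<longlonglongrightarrow> l\<close> \<open>strict_mono k\<close> by (rule LIMSEQ_subseq_LIMSEQ)
  ultimately show "l \<in> V"
    using LIMSEQ_unique by blast
qed

text \<open>The induction hypothesis serves twice. It makes \<open>span S\<close> closed, so a new
  vector \<open>b\<close> has positive distance to it and the coefficients of \<open>b\<close> are
  bounded; after a subsequence has been chosen for the coefficients, it is applied to the remaining
  parts in \<open>span S\<close>.\<close>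

lemma bounded_seq_finite_span:
  fixes S :: "'a::real_normed_vector set" and x :: "nat \<Rightarrow> 'a"
  assumes "finite S" and "\<And>n. x n \<in> span S" and "bounded (range x)"
  shows "\<exists>l\<in>span S. \<exists>k. strict_mono k \<and> (x \<circ> k) \<longlonglongrightarrow> l"
  using assms
proof (induction S arbitrary: x rule: finite_induct)
  case empty
  then have "x = (\<lambda>_. 0)" by auto
  then show ?case by (auto intro!: exI[of _ id] simp: strict_mono_def)
next
  case (insert b S)
  show ?case
  proof (cases "b \<in> span S")
    case True
    then have "span (insert b S) = span S" by (rule span_redundant)
    with insert show ?thesis by simp
  next
    case False
    have "closed (span S)"
      by (rule closed_if_bounded_subseq) (rule insert.IH)
    then have d: "infdist b (span S) > 0"
      using False infdist_pos_not_in_closed[of "span S" b] span_zero by blast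
    have "\<forall>n. \<exists>t. x n - t *\<^sub>R b \<in> span S"
      using insert.prems(1) by (simp add: span_insert)
    then obtain t where t: "x n - t n *\<^sub>R b \<in> span S" for n
      by metis
    obtain M where M: "norm (x n) \<le> M" for n
      using insert.prems(2) by (auto simp: bounded_iff)
    have "\<bar>t n\<bar> \<le> M / infdist b (span S)" for n
      using infdist_add_scaleR_le[OF subspace_span t, of "t n" b n] M[of n] d
      by (simp add: pos_le_divide_eq)
    then have tb: "bounded (range t)"
      by (auto simp: bounded_iff)
    then obtain t' k where k: "strict_mono k" "(t \<circ> k) \<longlonglongrightarrow> t'"
      using bounded_imp_convergent_subsequence by blast
    have "bounded (range (\<lambda>n. x n - t n *\<^sub>R b))"
      using bounded_linear_image[OF tb bounded_linear_scaleR_left[of b]]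
      by (intro bounded_minus_comp insert.prems(2)) (simp add: image_image)
    then have "bounded (range ((\<lambda>n. x n - t n *\<^sub>R b) \<circ> k))"
      by (rule bounded_subset) auto
    then obtain y j where j: "y \<in> span S" "strict_mono j" "(((\<lambda>n. x n - t n *\<^sub>R b) \<circ> k) \<circ> j) \<longlonglongrightarrow> y"
      using insert.IH[of "(\<lambda>n. x n - t n *\<^sub>R b) \<circ> k"] t unfolding o_apply by blast
    have "((t \<circ> k) \<circ> j) \<longlonglongrightarrow> t'"
      using k(2) j(2) by (rule LIMSEQ_subseq_LIMSEQ)
    from tendsto_add[OF j(3) tendsto_scaleR[OF this tendsto_const[of b]]]
    have "(x \<circ> (k \<circ> j)) \<longlonglongrightarrow> y + t' *\<^sub>R b"
      by (simp add: o_def)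
    moreover have "y + t' *\<^sub>R b \<in> span (insert b S)"
      using j(1) by (auto simp: span_insert intro!: exI[of _ t'])
    ultimately show ?thesis
      using strict_mono_o[OF k(1) j(2)] by blast
  qed
qed

lemma closed_span_finite:
  fixes S :: "'a::real_normed_vector set"
  assumes "finite S"
  shows "closed (span S)"
  by (rule closed_if_bounded_subseq) (rule bounded_seq_finite_span[OF assms])

lemma compact_if_finite_span:
  fixes S K :: "'a::real_normed_vector set"
  assumes "finite S" "span S = UNIV" "closed K" "bounded K"
  shows "compact K"
  unfolding compact_def
proof (intro allI impI)
  fix f :: "nat \<Rightarrow> 'a" assume f: "\<forall>n. f n \<in> K"
  then have "bounded (range f)"
    using assms(4) by (metis bounded_subset image_subsetI)
  then obtain l k where "strict_mono k" "(f \<circ> k) \<longlonglongrightarrow> l"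
    using bounded_seq_finite_span[OF assms(1), of f] assms(2) by auto
  moreover have "l \<in> K"
    using assms(3) f \<open>(f \<circ> k) \<longlonglongrightarrow> l\<close> closed_sequentially[of K "f \<circ> k" l] by simp
  ultimately show "\<exists>l\<in>K. \<exists>r. strict_mono r \<and> (f \<circ> r) \<longlonglongrightarrow> l" by blast
qed

lemma bounded_linear_finite_span:
  fixes S :: "'a::real_normed_vector set" and f :: "'a \<Rightarrow> 'b::real_normed_vector"
  assumes "finite S" "span S = UNIV" "linear f"
  shows "bounded_linear f"
proof -
  interpret linear f by fact
  have "\<exists>K. \<forall>x\<in>span S. norm (f x) \<le> norm x * K"
    using assms(1)
  proof (induction S rule: finite_induct)
    case empty
    then show ?case by (simp add: zero)
  next
    case (insert b S)
    then obtain K where K: "norm (f x) \<le> norm x * K" if "x \<in> span S" for x by blast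
    show ?case
    proof (cases "b \<in> span S")
      case True
      then have "span (insert b S) = span S" by (rule span_redundant)
      with K show ?thesis by auto
    next
      case False
      define d where "d = infdist b (span S)"
      have d: "d > 0"
        using False infdist_pos_not_in_closed[of "span S" b] closed_span_finite[OF insert.hyps(1)]
          span_zero unfolding d_def by blast
      \<comment> \<open>With \<open>\<bar>t\<bar> \<le> norm x / d\<close>, the part of
        \<open>x\<close> in \<open>span S\<close> has norm at most
        \<open>norm x * (1 + norm b / d)\<close>, and \<open>t *\<^sub>R b\<close> contributes the
        last summand. The absolute value is there because \<open>K\<close> could be negative when
        \<open>span S\<close> is trivial.\<close>
      have "norm (f x) \<le> norm x * ((1 + norm b / d) * \<bar>K\<bar> + norm (f b) / d)"
        if "x \<in> span (insert b S)" for x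
      proof -
        have "\<exists>t. x - t *\<^sub>R b \<in> span S"
          using that by (simp add: span_insert)
        then obtain t where t: "x - t *\<^sub>R b \<in> span S" ..
        have td: "\<bar>t\<bar> \<le> norm x / d"
          using infdist_add_scaleR_le[OF subspace_span t, of t b] d
          by (simp add: pos_le_divide_eq d_def)
        have "norm (x - t *\<^sub>R b) \<le> norm x + \<bar>t\<bar> * norm b"
          using norm_triangle_ineq4[of x "t *\<^sub>R b"] by simp
        also have "\<dots> \<le> norm x + norm x / d * norm b"
          using mult_right_mono[OF td, of "norm b"] by simp
        finally have y: "norm (x - t *\<^sub>R b) \<le> norm x * (1 + norm b / d)"
          by (simp add: algebra_simps)
        have "norm (f x) \<le> norm (f (x - t *\<^sub>R b)) + norm (f (t *\<^sub>R b))"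
          by (metis add diff_add_cancel norm_triangle_ineq)
        also have "norm (f (t *\<^sub>R b)) = \<bar>t\<bar> * norm (f b)"
          by (simp add: scale)
        also have "\<dots> \<le> norm x / d * norm (f b)"
          using mult_right_mono[OF td, of "norm (f b)"] by simp
        also have "norm (f (x - t *\<^sub>R b)) \<le> norm (x - t *\<^sub>R b) * \<bar>K\<bar>"
          using K[OF t] by (smt (verit) mult_left_mono norm_ge_zero)
        also have "\<dots> \<le> norm x * (1 + norm b / d) * \<bar>K\<bar>"
          using y by (simp add: mult_right_mono)
        finally show ?thesis by (simp add: algebra_simps)
      qed
      then show ?thesis by blast
    qed
  qed
  then show ?thesis
    using assms(2) by (intro bounded_linear.intro bounded_linear_axioms.intro assms(3)) simp
qed

section \<open>Polynomials in an endomorphism and common eigenvalues\<close>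

text \<open>This is \<open>p(T) v\<close>, evaluated by Horner's rule. The scalar multiplication is
  a parameter because both the real space and its complexification occur.\<close>

definition poly_op :: "('k::zero \<Rightarrow> 'v::monoid_add \<Rightarrow> 'v) \<Rightarrow> ('v \<Rightarrow> 'v) \<Rightarrow> 'k poly \<Rightarrow> 'v \<Rightarrow> 'v" where
  "poly_op s T p v = fold_coeffs (\<lambda>a w. s a v + T w) p 0"

lemma poly_op_0 [simp]: "poly_op s T 0 v = 0"
  by (simp add: poly_op_def)

context
  fixes s :: "'k::field \<Rightarrow> 'v::ab_group_add \<Rightarrow> 'v" and T
  assumes linT: "Vector_Spaces.linear s s T"
begin

interpretation T: Vector_Spaces.linear s s T by (fact linT)

lemma poly_op_pCons [simp]: "poly_op s T (pCons a p) v = s a v + T (poly_op s T p v)"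
  by (cases "p = 0 \<and> a = 0") (auto simp: poly_op_def T.zero)

lemma poly_op_add: "poly_op s T (p + q) v = poly_op s T p v + poly_op s T q v"
  by (induction p q rule: poly_induct2) (simp_all add: T.vs1.scale_left_distrib T.add)

lemma poly_op_smult: "poly_op s T (smult c p) v = s c (poly_op s T p v)"
  by (induction p) (simp_all add: T.vs1.scale_right_distrib T.scale)

lemma poly_op_sum: "poly_op s T (sum f I) v = (\<Sum>i\<in>I. poly_op s T (f i) v)"
  by (induction I rule: infinite_finite_induct) (simp_all add: poly_op_add)

lemma poly_op_monom: "poly_op s T (monom c n) v = s c ((T ^^ n) v)"
  by (induction n) (simp_all add: monom_0 monom_Suc T.scale T.zero)

lemma poly_op_linear_factor:
  "poly_op s T ([:- z, 1:] * q) v = T (poly_op s T q v) - s z (poly_op s T q v)"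
proof -
  have "[:- z, 1:] * q = smult (- z) q + pCons 0 q"
    by simp
  then show ?thesis
    by (simp only: poly_op_add poly_op_smult poly_op_pCons) simp
qed

lemma poly_op_add_right: "poly_op s T p (v + w) = poly_op s T p v + poly_op s T p w"
  by (induction p) (simp_all add: T.vs1.scale_right_distrib T.add)

lemma poly_op_in_subspace:
  assumes "T.vs1.subspace G" "T ` G \<subseteq> G" "v \<in> G"
  shows "poly_op s T p v \<in> G"
  using assms
  by (induction p) (auto simp: T.vs1.subspace_0 intro!: T.vs1.subspace_add T.vs1.subspace_scale)

text \<open>The vectors \<open>v, T v, ..., T^d v\<close> with \<open>d = card S\<close> are one too
  many to be independent.\<close>

lemma annihilating_poly_exists:
  assumes "finite S" "T.vs1.span S = UNIV"
  obtains p where "p \<noteq> 0" "poly_op s T p v = 0"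
proof -
  define f where "f i = (T ^^ i) v" for i
  have "\<exists>c. (\<exists>i\<le>card S. c i \<noteq> 0) \<and> (\<Sum>i\<le>card S. s (c i) (f i)) = 0"
  proof (cases "inj_on f {..card S}")
    case True
    then have "T.vs1.dependent (f ` {..card S})"
      using T.vs1.independent_span_bound[OF assms(1), of "f ` {..card S}"] assms(2)
      by (auto simp: card_image)
    then obtain u where "\<exists>w\<in>f ` {..card S}. u w \<noteq> 0" "(\<Sum>w\<in>f ` {..card S}. s (u w) w) = 0"
      by (auto simp: T.vs1.dependent_finite)
    then show ?thesis
      using True by (intro exI[of _ "u \<circ> f"]) (auto simp: sum.reindex)
  next
    \<comment> \<open>Dependence is a property of sets, so a repeated iterate is treated apart: it
      is itself a relation, with coefficients 1 and -1.\<close>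
    case False
    then obtain i j where ij: "i \<le> card S" "j \<le> card S" "i \<noteq> j" "f i = f j"
      by (auto simp: inj_on_def)
    define c where "c k = (if k = i then 1 else if k = j then - 1 else 0 :: 'k)" for k
    have "(\<Sum>k\<le>card S. s (c k) (f k)) = (\<Sum>k\<in>{i, j}. s (c k) (f k))"
      using ij by (intro sum.mono_neutral_right) (auto simp: c_def)
    then show ?thesis
      using ij by (intro exI[of _ c]) (auto simp: c_def)
  qed
  then obtain c i where c: "i \<le> card S" "c i \<noteq> 0" "(\<Sum>i\<le>card S. s (c i) (f i)) = 0"
    by blast
  define p where "p = (\<Sum>i\<le>card S. monom (c i) i)"
  have "coeff p i \<noteq> 0"
    using c by (simp add: p_def coeff_sum)
  then have "p \<noteq> 0" by auto
  moreover have "poly_op s T p v = 0"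
    using c(3) by (simp add: p_def poly_op_sum poly_op_monom f_def)
  ultimately show ?thesis by (rule that)
qed

end

text \<open>
  Take \<open>p\<close> of least degree annihilating \<open>v\<close> and a divisor \<open>q\<close> of \<open>p\<close> of least degree
  annihilating \<open>w\<close>: by minimality, a root of \<open>q\<close> is an eigenvalue for both.
\<close>

lemma common_eigenvalue:
  fixes s :: "'k::alg_closed_field \<Rightarrow> 'v::ab_group_add \<Rightarrow> 'v"
  assumes lin: "Vector_Spaces.linear s s T"
    and G: "module.subspace s G" "T ` G \<subseteq> G" "v \<in> G"
    and F: "module.subspace s F" "T ` F \<subseteq> F" "w \<in> F" "w \<noteq> 0"
    and ann: "\<exists>p. p \<noteq> 0 \<and> poly_op s T p v = 0"
    and vw: "\<And>p. poly_op s T p v = 0 \<Longrightarrow> poly_op s T p w = 0"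
  shows "\<exists>z. z \<in> eigenvalues_on s G T \<and> z \<in> eigenvalues_on s F T"
proof -
  interpret T: Vector_Spaces.linear s s T by (fact lin)
  obtain p where p: "p \<noteq> 0" "poly_op s T p v = 0"
    and p_min: "\<And>p'. \<lbrakk>p' \<noteq> 0; poly_op s T p' v = 0\<rbrakk> \<Longrightarrow> degree p \<le> degree p'"
    using arg_min_natI[of "\<lambda>p. p \<noteq> 0 \<and> poly_op s T p v = 0" _ degree]
      arg_min_nat_le[of "\<lambda>p. p \<noteq> 0 \<and> poly_op s T p v = 0" _ degree] ann
    by (metis (mono_tags, lifting))
  \<comment> \<open>Minimising among divisors of \<open>p\<close> makes every root of
    \<open>q\<close> a root of \<open>p\<close> without a division with remainder. The polynomial
    \<open>p\<close> itself is a candidate by \<open>vw\<close>.\<close>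
  let ?Q = "\<lambda>q. q dvd p \<and> poly_op s T q w = 0"
  obtain q where q: "q dvd p" "poly_op s T q w = 0"
    and q_min: "\<And>q'. \<lbrakk>q' dvd p; poly_op s T q' w = 0\<rbrakk> \<Longrightarrow> degree q \<le> degree q'"
    using arg_min_natI[of ?Q p degree] arg_min_nat_le[of ?Q _ degree] vw[OF p(2)]
    by (metis (mono_tags, lifting) dvd_refl)
  have "q \<noteq> 0"
    using p(1) q(1) by auto
  have "degree q \<noteq> 0"
  proof
    assume "degree q = 0"
    then obtain c where c: "q = [:c:]" by (rule degree_eq_zeroE)
    then have "s c w = 0"
      using q(2) by (simp add: poly_op_pCons[OF lin] T.zero)
    then show False
      using c \<open>q \<noteq> 0\<close> F(4) by simp
  qed
  then obtain z where z: "poly q z = 0"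
    using alg_closed_imp_poly_has_root[of q] by auto
  then obtain q' where q': "q = [:- z, 1:] * q'"
    by (auto simp: poly_eq_0_iff_dvd)
  obtain p' where p': "p = [:- z, 1:] * p'"
    using q(1) q' by (metis dvd_def mult.assoc)
  have "p' \<noteq> 0" "q' \<noteq> 0"
    using p' q' p(1) \<open>q \<noteq> 0\<close> by auto
  then have deg: "degree p = Suc (degree p')" "degree q = Suc (degree q')"
    by (simp_all add: p' q' degree_mult_eq del: mult_pCons_left)
  have "poly_op s T p' v \<noteq> 0"
    using p_min[of p'] deg \<open>p' \<noteq> 0\<close> by auto
  moreover have "T (poly_op s T p' v) = s z (poly_op s T p' v)"
    using p(2) by (simp add: p' poly_op_linear_factor[OF lin] del: mult_pCons_left)
  ultimately have "z \<in> eigenvalues_on s G T"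
    using poly_op_in_subspace[OF lin G, of p'] by (auto simp: eigenvalues_on_def)
  have "q' dvd p"
    using q(1) q' by (metis dvd_mult_right)
  then have "poly_op s T q' w \<noteq> 0"
    using q_min[of q'] deg by auto
  moreover have "T (poly_op s T q' w) = s z (poly_op s T q' w)"
    using q(2) by (simp add: q' poly_op_linear_factor[OF lin] del: mult_pCons_left)
  ultimately have "z \<in> eigenvalues_on s F T"
    using poly_op_in_subspace[OF lin F(1-3), of q'] by (auto simp: eigenvalues_on_def)
  with \<open>z \<in> eigenvalues_on s G T\<close> show ?thesis by blast
qed

section \<open>Complexification and the spectrum\<close>

text \<open>Only real scalars enter, so over either field this is the complexification of the
  underlying real space.\<close>

lemma complexify_scale_of_real:
  fixes s :: "'k::real_or_complex \<Rightarrow> 'v::real_vector \<Rightarrow> 'v"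
  assumes "\<forall>t x. s (of_real t) x = t *\<^sub>R x"
  shows "complexify_scale s = (\<lambda>z p.
    (Re z *\<^sub>R fst p - Im z *\<^sub>R snd p, Re z *\<^sub>R snd p + Im z *\<^sub>R fst p))"
  using assms by (simp add: complexify_scale_def fun_eq_iff)

lemma vector_space_complexify:
  fixes s :: "'k::real_or_complex \<Rightarrow> 'v::real_vector \<Rightarrow> 'v"
  assumes "\<forall>t x. s (of_real t) x = t *\<^sub>R x"
  shows "vector_space (complexify_scale s)"
  unfolding complexify_scale_of_real[OF assms]
  by standard (auto simp: algebra_simps prod_eq_iff)

lemma linear_complexify:
  fixes s :: "'k::real_or_complex \<Rightarrow> 'v::real_vector \<Rightarrow> 'v"
  assumes "\<forall>t x. s (of_real t) x = t *\<^sub>R x" and "linear A"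
  shows "Vector_Spaces.linear (complexify_scale s) (complexify_scale s) (map_prod A A)"
proof -
  interpret A: linear A by fact
  interpret vector_space "complexify_scale s" by (rule vector_space_complexify) fact
  show ?thesis
    by unfold_locales
      (auto simp: complexify_scale_of_real[OF assms(1)] A.add A.diff A.scale prod_eq_iff)
qed

lemma subspace_complexify:
  fixes s :: "'k::real_or_complex \<Rightarrow> 'v::real_vector \<Rightarrow> 'v"
  assumes "\<forall>t x. s (of_real t) x = t *\<^sub>R x" and "subspace F"
  shows "module.subspace (complexify_scale s) (F \<times> F)"
proof -
  interpret vector_space "complexify_scale s" by (rule vector_space_complexify) fact
  show ?thesis
    using assms(2) unfolding subspace_def
    by (simp add: complexify_scale_of_real[OF assms(1)] zero_prod_def mem_Times_iff
        real_vector.subspace_0 real_vector.subspace_add real_vector.subspace_diff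
        real_vector.subspace_scale)
qed

text \<open>Carries an annihilating polynomial, found in the real space by counting dimensions, over
  to the complexification.\<close>

lemma poly_op_complexify:
  fixes s :: "'k::real_or_complex \<Rightarrow> 'v::real_vector \<Rightarrow> 'v"
  assumes "\<forall>t x. s (of_real t) x = t *\<^sub>R x" and "linear A"
  shows "poly_op (complexify_scale s) (map_prod A A) (map_poly of_real p) (x, 0)
    = (poly_op (*\<^sub>R) A p x, 0)"
proof (induction p)
  case (pCons a p)
  have "Vector_Spaces.linear (*\<^sub>R) (*\<^sub>R) A"
    using assms(2) by (simp add: linear_def)
  moreover have "complexify_scale s (of_real a) (x, 0) = (a *\<^sub>R x, 0)"
    by (simp add: complexify_scale_of_real[OF assms(1)])
  ultimately show ?case
    using pCons by (simp add: map_poly_pCons poly_op_pCons linear_complexify[OF assms]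
        linear_0[OF assms(2)])
qed (simp add: zero_prod_def)

text \<open>A polynomial that annihilates \<open>f + f'\<close> sends the two summands into
  \<open>F\<close> and \<open>F'\<close>, with sum 0. These meet only in 0, so it annihilates
  \<open>f\<close> alone, which is the condition for a common eigenvalue.\<close>

lemma common_eigenvalue_of_sum:
  fixes s :: "'k::real_or_complex \<Rightarrow> 'v::real_vector \<Rightarrow> 'v" and S :: "'v set"
  assumes s: "\<forall>t x. s (of_real t) x = t *\<^sub>R x" and A: "linear A"
    and S: "finite S" "span S = UNIV"
    and sub: "subspace G" "subspace F" "subspace F'"
    and inv: "A ` G \<subseteq> G" "A ` F \<subseteq> F" "A ` F' \<subseteq> F'"
    and "F \<inter> F' = {0}" "f + f' \<in> G" "f \<in> F" "f' \<in> F'" "f \<noteq> 0"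
  shows "\<exists>z. z \<in> eigenvalues_on (complexify_scale s) (G \<times> G) (map_prod A A) \<and>
    z \<in> eigenvalues_on (complexify_scale s) (F \<times> F) (map_prod A A)"
proof (rule common_eigenvalue[where v = "(f + f', 0)" and w = "(f, 0)"])
  let ?sc = "complexify_scale s" and ?T = "map_prod A A"
  show lin: "Vector_Spaces.linear ?sc ?sc ?T"
    using s A by (rule linear_complexify)
  show "module.subspace ?sc (G \<times> G)" "module.subspace ?sc (F \<times> F)"
    using s sub by (auto intro: subspace_complexify)
  show "(f + f', 0) \<in> G \<times> G" "(f, 0) \<in> F \<times> F"
    using assms by (auto simp: subspace_0)
  have A': "Vector_Spaces.linear (*\<^sub>R) (*\<^sub>R) A"
    using A by (simp add: linear_def)
  obtain p where "p \<noteq> 0" "poly_op (*\<^sub>R) A p (f + f') = 0"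
    using annihilating_poly_exists[OF A' S(1), of "f + f'"] S(2) by (auto simp: span_raw_def)
  then have "map_poly complex_of_real p \<noteq> 0"
      "poly_op ?sc ?T (map_poly of_real p) (f + f', 0) = 0"
    by (auto simp: poly_op_complexify[OF s A] map_poly_eq_0_iff zero_prod_def)
  then show "\<exists>p. p \<noteq> 0 \<and> poly_op ?sc ?T p (f + f', 0) = 0" by blast
  show "poly_op ?sc ?T p (f, 0) = 0" if "poly_op ?sc ?T p (f + f', 0) = 0" for p
  proof -
    have F: "poly_op ?sc ?T p (f, 0) \<in> F \<times> F"
      using s assms by (intro poly_op_in_subspace[OF lin] subspace_complexify) (auto simp: subspace_0)
    have F': "poly_op ?sc ?T p (f', 0) \<in> F' \<times> F'"
      using s assms by (intro poly_op_in_subspace[OF lin] subspace_complexify) (auto simp: subspace_0)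
    have "poly_op ?sc ?T p (f, 0) + poly_op ?sc ?T p (f', 0) = 0"
      using that poly_op_add_right[OF lin, of p "(f, 0)" "(f', 0)"] by simp
    then have "poly_op ?sc ?T p (f, 0) = - poly_op ?sc ?T p (f', 0)"
      by (simp add: eq_neg_iff_add_eq_0)
    then have "poly_op ?sc ?T p (f, 0) \<in> F' \<times> F'"
      using F' sub(3) by (metis fst_uminus mem_Times_iff snd_uminus subspace_neg)
    with F have "poly_op ?sc ?T p (f, 0) \<in> {0} \<times> {0}"
      unfolding \<open>F \<inter> F' = {0}\<close>[symmetric] by (simp add: mem_Times_iff)
    then show ?thesis
      by (simp add: mem_Times_iff prod_eq_iff)
  qed
qed (use assms in \<open>auto simp: zero_prod_def\<close>)

lemma scalar_decomposition:
  fixes c j :: "'k::real_or_complex"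
  assumes "to_complex j = \<i>"
  shows "c = of_real (Re (to_complex c)) + of_real (Im (to_complex c)) * j"
  by (rule injD[OF inj_to_complex])
    (simp add: to_complex_add to_complex_mult to_complex_of_real assms complex_eq mult.commute)

text \<open>
  Over \<open>\<complex>\<close>, the complexification of \<open>A|F\<close> has the eigenvalues of \<open>A|F\<close> and their conjugates.
\<close>

lemma cmod_spectrum_on:
  fixes s :: "'k::real_or_complex \<Rightarrow> 'v::real_vector \<Rightarrow> 'v"
  assumes s: "\<forall>t x. s (of_real t) x = t *\<^sub>R x"
    and A: "Vector_Spaces.linear s s A" and F: "module.subspace s F"
  shows "cmod ` spectrum_on s F A
    = cmod ` eigenvalues_on (complexify_scale s) (F \<times> F) (map_prod A A)"
proof (cases "range (to_complex :: 'k \<Rightarrow> complex) = \<real>")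
  case False
  interpret A: Vector_Spaces.linear s s A by (fact A)
  have onto: "range (to_complex :: 'k \<Rightarrow> complex) = UNIV"
    using False range_to_complex by blast
  obtain j :: 'k where j: "to_complex j = \<i>"
    using onto by (metis UNIV_I imageE)
  have "to_complex (j * j) = - 1" "to_complex (- 1 :: 'k) = - 1"
    using to_complex_of_real[of "- 1", where 'k = 'k] by (simp_all add: to_complex_mult j)
  then have jj: "j * j = - 1"
    by (metis injD[OF inj_to_complex])
  then have sjj: "s j (s j x) = - x" for x
    by (simp add: A.vs1.scale_minus_left)
  have s_eq: "s c x = Re (to_complex c) *\<^sub>R x + Im (to_complex c) *\<^sub>R s j x" for c x
    using s by (subst scalar_decomposition[OF j]) (simp add: A.vs1.scale_left_distrib flip: A.vs1.scale_scale)
  have s_real: "s j (t *\<^sub>R x) = t *\<^sub>R s j x" for t x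
    using s by (metis A.vs1.scale_left_commute)
  show ?thesis
  proof (intro equalityI subsetI; elim imageE)
    fix u z assume "z \<in> spectrum_on s F A" and u: "u = cmod z"
    then obtain c v where c: "z = to_complex c" "v \<in> F" "v \<noteq> 0" "A v = s c v"
      using False by (auto simp: spectrum_on_def eigenvalues_on_def)
    \<comment> \<open>The pair stands for \<open>v - i (j v)\<close>, a vector on which the formal
      \<open>i\<close> of the complexification acts as the scalar \<open>j\<close>. Hence the
      eigenvalue is \<open>z\<close> and not its conjugate.\<close>
    define p where "p = (v, - s j v)"
    have "p \<in> F \<times> F" "p \<noteq> 0"
      using c A.vs1.subspace_scale[OF F] A.vs1.subspace_neg[OF F] by (auto simp: p_def zero_prod_def)
    moreover have "map_prod A A p = complexify_scale s z p"
      using c(4) by (simp add: p_def complexify_scale_of_real[OF s] A.neg A.scale s_eq[of c] c(1)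
          A.vs1.scale_right_distrib s_real sjj jj)
    ultimately show "u \<in> cmod ` eigenvalues_on (complexify_scale s) (F \<times> F) (map_prod A A)"
      using u unfolding eigenvalues_on_def by blast
  next
    fix u z assume z: "z \<in> eigenvalues_on (complexify_scale s) (F \<times> F) (map_prod A A)"
      and u: "u = cmod z"
    then obtain x y where xy: "x \<in> F" "y \<in> F" "x \<noteq> 0 \<or> y \<noteq> 0"
        "A x = Re z *\<^sub>R x - Im z *\<^sub>R y" "A y = Re z *\<^sub>R y + Im z *\<^sub>R x"
      by (auto simp: eigenvalues_on_def complexify_scale_of_real[OF s] zero_prod_def)
    \<comment> \<open>Substituting \<open>j\<close> or \<open>-j\<close> for the formal
      \<open>i\<close> in \<open>x + i y\<close> yields candidates for eigenvectors with eigenvalues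
      \<open>z\<close> and its conjugate. One of them may vanish but not both, so only the modulus
      of \<open>z\<close> is recovered.\<close>
    obtain c d :: 'k where cd: "to_complex c = z" "to_complex d = cnj z"
      using onto by (metis UNIV_I imageE)
    have c: "s c (x + s j y) = Re z *\<^sub>R (x + s j y) + Im z *\<^sub>R (s j x - y)"
      by (subst s_eq) (simp add: cd sjj A.vs1.scale_right_distrib del: A.vs1.scale_scale)
    have 1: "A (x + s j y) = s c (x + s j y)"
      unfolding c using xy by (simp add: A.add A.scale s_real A.vs1.scale_right_distrib algebra_simps)
    have d: "s d (x - s j y) = Re z *\<^sub>R (x - s j y) - Im z *\<^sub>R (s j x + y)"
      by (subst s_eq) (simp add: cd sjj A.vs1.scale_right_diff_distrib del: A.vs1.scale_scale)
    have 2: "A (x - s j y) = s d (x - s j y)"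
      unfolding d using xy by (simp add: A.diff A.scale s_real A.vs1.scale_right_distrib algebra_simps)
    have "x + s j y \<noteq> 0 \<or> x - s j y \<noteq> 0"
    proof (rule ccontr)
      assume *: "\<not> ?thesis"
      then have 0: "x + s j y = 0" "x - s j y = 0" by blast+
      have "2 *\<^sub>R x = (x + s j y) + (x - s j y)" by (simp add: scaleR_2)
      also have "\<dots> = 0" unfolding 0 by simp
      finally have "x = 0" by simp
      then have "s j (s j y) = 0" using * by simp
      then show False using \<open>x = 0\<close> xy(3) by (simp add: sjj jj)
    qed
    moreover have "x + s j y \<in> F" "x - s j y \<in> F"
      using xy F by (auto intro: A.vs1.subspace_add A.vs1.subspace_diff A.vs1.subspace_scale)
    ultimately have "c \<in> eigenvalues_on s F A \<or> d \<in> eigenvalues_on s F A"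
      using 1 2 unfolding eigenvalues_on_def by blast
    then show "u \<in> cmod ` spectrum_on s F A"
    proof
      assume "c \<in> eigenvalues_on s F A"
      then show ?thesis using u cd(1) False by (force simp: spectrum_on_def image_iff)
    next
      assume "d \<in> eigenvalues_on s F A"
      moreover have "u = cmod (to_complex d)" using u cd(2) by simp
      ultimately show ?thesis using False by (force simp: spectrum_on_def image_iff)
    qed
  qed
qed (simp add: spectrum_on_def)

section \<open>The invariant subspaces of a dominating map\<close>

lemma linear_funpow:
  fixes A :: "'a::real_vector \<Rightarrow> 'a"
  shows "linear A \<Longrightarrow> linear (A ^^ n)"
proof (induction n)
  case 0
  then show ?case by (simp add: linear_iff)
next
  case (Suc n)
  then have "linear (A \<circ> A ^^ n)"
    by (intro linear_compose) auto
  then show ?case by (simp add: o_def)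
qed

lemma linear_inj_imp_surj_finite_span:
  fixes f :: "'a::real_vector \<Rightarrow> 'a" and S :: "'a set"
  assumes "finite S" "span S = UNIV" "linear f" "inj f"
  shows "surj f"
proof -
  obtain B where B: "B \<subseteq> S" "independent B" "S \<subseteq> span B"
    using real_vector.maximal_independent_subset[of S] by blast
  then have "span B = UNIV"
    using assms(2) span_minimal[OF B(3) subspace_span] by auto
  then interpret finite_dimensional_vector_space "(*\<^sub>R) :: real \<Rightarrow> 'a \<Rightarrow> 'a" B
    using B assms(1)
    by unfold_locales (auto simp: dependent_raw_def span_raw_def finite_subset)
  show ?thesis
    using linear_inj_imp_surj[of f] assms(3,4) by (simp add: linear_def)
qed

lemma nested_compact_inter:
  fixes K :: "nat \<Rightarrow> 'a::t2_space set"
  assumes "compact (K 0)" "\<And>n. closed (K n)" "\<And>n. K n \<noteq> {}" "\<And>n. K (Suc n) \<subseteq> K n"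
  shows "\<exists>x. \<forall>n. x \<in> K n"
proof -
  have "K 0 \<inter> (\<Inter>n\<in>UNIV. K n) \<noteq> {}"
  proof (rule compact_imp_fip_image)
    fix I :: "nat set" assume "finite I"
    define M where "M = Max (insert 0 I)"
    have "K M \<subseteq> K n" if "n \<in> insert 0 I" for n
    proof (rule lift_Suc_antimono_le[of K])
      show "n \<le> M"
        unfolding M_def using that \<open>finite I\<close> by (intro Max_ge) auto
    qed (use assms(4) in auto)
    then have "K M \<subseteq> K 0 \<inter> (\<Inter>n\<in>I. K n)"
      by blast
    then show "K 0 \<inter> (\<Inter>n\<in>I. K n) \<noteq> {}"
      using assms(3) by blast
  qed (use assms in auto)
  then show ?thesis by blast
qed

text \<open>After division by \<open>m ^ n\<close> the right side tends to 0. Every comparison of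
  two exponential growth rates below ends here, so multiplicative constants in the estimates do no
  harm.\<close>

lemma geometric_comparison:
  fixes a K l m :: real
  assumes "0 \<le> l" "l < m" "\<And>n. m ^ n * a \<le> K * l ^ n"
  shows "a \<le> 0"
proof -
  have "a \<le> K * (l / m) ^ n" for n
    using assms(3)[of n] assms(1,2) by (simp add: power_divide field_simps)
  moreover have "(\<lambda>n. K * (l / m) ^ n) \<longlonglongrightarrow> K * 0"
    using assms(1,2) by (intro tendsto_mult_left LIMSEQ_realpow_zero) auto
  ultimately show ?thesis
    using LIMSEQ_le_const[of "\<lambda>n. K * (l / m) ^ n" 0 a] by auto
qed

section \<open>Elementary properties of the cone norm and the cones\<close>

lemma cone_norm_nonneg: "0 \<le> cone_norm r x"
  by (simp add: cone_norm_def le_max_iff_disj)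

lemma cone_norm_0 [simp]: "cone_norm r 0 = 0"
  by (simp add: cone_norm_def)

lemma cone_norm_eq_0 [simp]: "r > 0 \<Longrightarrow> cone_norm r x = 0 \<longleftrightarrow> x = 0"
  by (auto simp: cone_norm_def max_def prod_eq_iff mult_le_0_iff split: if_splits)

lemma cone_norm_triangle: "r > 0 \<Longrightarrow> cone_norm r (x + y) \<le> cone_norm r x + cone_norm r y"
  unfolding cone_norm_def
  using norm_triangle_ineq[of "fst x" "fst y"]
    mult_left_mono[OF norm_triangle_ineq[of "snd x" "snd y"], of r]
  by (auto simp: distrib_left)

lemma cone_norm_scale:
  assumes "norm (fst y) = c * norm (fst x)" "norm (snd y) = c * norm (snd x)" "c \<ge> 0"
  shows "cone_norm r y = c * cone_norm r x"
  using assms by (simp add: cone_norm_def max_mult_distrib_left mult.left_commute)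

lemma cone_norm_scaleR: "cone_norm r (t *\<^sub>R x) = \<bar>t\<bar> * cone_norm r x"
  by (rule cone_norm_scale) auto

lemma cone_norm_expanding: "x \<in> expanding_cone r \<Longrightarrow> cone_norm r x = r * norm (snd x)"
  by (simp add: cone_norm_def expanding_cone_def)

lemma cones_cover: "x \<in> contracting_cone r \<or> x \<in> expanding_cone r"
  by (auto simp: contracting_cone_def expanding_cone_def)

lemma zero_in_cones [simp]: "0 \<in> contracting_cone r" "0 \<in> expanding_cone r"
  by (simp_all add: contracting_cone_def expanding_cone_def)

text \<open>
  The bound \<open>m\<close> is kept separate from the expansion rate because the latter may be infinite.
\<close>

locale cone_splitting =
  fixes A :: "'a::real_normed_vector \<times> 'b::real_normed_vector \<Rightarrow> 'a \<times> 'b"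
    and S1 :: "'a set" and S2 :: "'b set" and r l m :: real
  assumes lin: "linear A"
    and S1: "finite S1" "span S1 = UNIV" and S2: "finite S2" "span S2 = UNIV"
    and r_pos: "r > 0" and l_nonneg: "0 \<le> l" and l_less_m: "l < m"
    and contract: "A x \<in> contracting_cone r \<Longrightarrow> cone_norm r (A x) \<le> l * cone_norm r x"
    and expand: "x \<in> expanding_cone r \<Longrightarrow> m * cone_norm r x \<le> cone_norm r (A x)"
begin

abbreviation N where "N \<equiv> cone_norm r"
abbreviation C where "C \<equiv> contracting_cone r :: ('a \<times> 'b) set"
abbreviation D where "D \<equiv> expanding_cone r :: ('a \<times> 'b) set"

sublocale A: linear A by (fact lin)

lemma m_pos: "m > 0"
  using l_nonneg l_less_m by linarith

lemma linear_pow: "linear (A ^^ n)"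
  using lin by (rule linear_funpow)

lemma N_le_0: "N x \<le> 0 \<longleftrightarrow> x = 0"
  using cone_norm_eq_0[OF r_pos, of x] cone_norm_nonneg[of r x] by (metis antisym order_refl)

text \<open>Both estimates apply to the same vector, so \<open>m * N x \<le> l * N x\<close>. Both
  cone invariances follow from this, as do \<open>F1 \<inter> F2 = {0}\<close> and the injectivity
  of \<open>A\<close> on \<open>F2\<close>.\<close>

lemma expanding_to_contracting_0:
  assumes "x \<in> D" "A x \<in> C"
  shows "x = 0"
proof (rule ccontr)
  assume "x \<noteq> 0"
  then have "l * N x < m * N x"
    using N_le_0[of x] l_less_m by (intro mult_strict_right_mono) auto
  also have "\<dots> \<le> N (A x)"
    using assms(1) by (rule expand)
  also have "\<dots> \<le> l * N x"
    using assms(2) by (rule contract)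
  finally show False by simp
qed

lemma expanding_invariant: "x \<in> D \<Longrightarrow> A x \<in> D"
  using expanding_to_contracting_0[of x] cones_cover[of "A x" r] A.zero by auto

lemma contracting_backward: "A x \<in> C \<Longrightarrow> x \<in> C"
  using expanding_to_contracting_0[of x] cones_cover[of x r] by auto

lemma expanding_pow: "x \<in> D \<Longrightarrow> (A ^^ n) x \<in> D \<and> m ^ n * N x \<le> N ((A ^^ n) x)"
proof (induction n)
  case (Suc n)
  then have "m * (m ^ n * N x) \<le> m * N ((A ^^ n) x)"
    using m_pos by (intro mult_left_mono) auto
  also have "\<dots> \<le> N (A ((A ^^ n) x))"
    using Suc by (intro expand) auto
  finally show ?case
    using Suc expanding_invariant by (auto simp: mult.assoc)
qed auto

text \<open>A condition on the last iterate suffices: backward invariance puts all earlier iterates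
  in the cone, so every single step contracts.\<close>

lemma contracting_pow: "(A ^^ n) x \<in> C \<Longrightarrow> x \<in> C \<and> N ((A ^^ n) x) \<le> l ^ n * N x"
proof (induction n)
  case (Suc n)
  have IH: "x \<in> C" "N ((A ^^ n) x) \<le> l ^ n * N x"
    using Suc contracting_backward by auto
  have "N (A ((A ^^ n) x)) \<le> l * N ((A ^^ n) x)"
    using Suc.prems by (intro contract) auto
  also have "\<dots> \<le> l * (l ^ n * N x)"
    using IH l_nonneg by (intro mult_left_mono)
  finally show ?case
    using IH by (simp add: mult.assoc)
qed auto

text \<open>A growth bound passes to sums, which membership of all iterates in the cone does not
  visibly do. For \<open>l = 0\<close> the set is the kernel of \<open>A\<close>, since
  \<open>0 ^ 0 = 1\<close>.\<close>

definition F1 where "F1 = {x. \<exists>K. \<forall>n. N ((A ^^ n) x) \<le> K * l ^ n}"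
text \<open>As \<open>A\<close> may fail to be injective, preimages are only asked to exist,
  separately for each \<open>n\<close>; they need not form one backward orbit. The constant
  \<open>K\<close> is common to all \<open>n\<close>.\<close>

definition F2 where "F2 = {x. \<exists>K. \<forall>n. \<exists>z. (A ^^ n) z = x \<and> m ^ n * N z \<le> K}"

section \<open>Linearity and invariance of the two growth spaces\<close>

lemma F1_add: assumes "x \<in> F1" "y \<in> F1" shows "x + y \<in> F1"
proof -
  obtain K L where KL: "N ((A ^^ n) x) \<le> K * l ^ n" "N ((A ^^ n) y) \<le> L * l ^ n" for n
    using assms by (auto simp: F1_def)
  have "N ((A ^^ n) (x + y)) \<le> (K + L) * l ^ n" for n
    using cone_norm_triangle[OF r_pos, of "(A ^^ n) x" "(A ^^ n) y"] KL[of n]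
    by (simp add: linear_add[OF linear_pow] distrib_right)
  then show ?thesis by (auto simp: F1_def)
qed

lemma F2_add: assumes "x \<in> F2" "y \<in> F2" shows "x + y \<in> F2"
proof -
  obtain K L u v where *: "(A ^^ n) (u n) = x" "m ^ n * N (u n) \<le> K"
      "(A ^^ n) (v n) = y" "m ^ n * N (v n) \<le> L" for n
    using assms unfolding F2_def mem_Collect_eq by metis
  have "m ^ n * N (u n + v n) \<le> K + L" for n
    using mult_left_mono[OF cone_norm_triangle[OF r_pos, of "u n" "v n"], of "m ^ n"]
      *(2,4)[of n] m_pos by (simp add: distrib_left)
  moreover have "(A ^^ n) (u n + v n) = x + y" for n
    using * by (simp add: linear_add[OF linear_pow])
  ultimately show ?thesis unfolding F2_def by blast
qed

lemma commute_pow: "(\<And>x. A (g x) = g (A x)) \<Longrightarrow> (A ^^ n) (g x) = g ((A ^^ n) x)"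
  by (induction n) auto

text \<open>The map \<open>g\<close> stands for multiplication by an arbitrary scalar of the field,
  of which the locale sees only the real ones.\<close>

lemma F1_scale:
  assumes "\<And>x. A (g x) = g (A x)" "\<And>x. N (g x) = c * N x" "c \<ge> 0" "x \<in> F1"
  shows "g x \<in> F1"
proof -
  obtain K where "N ((A ^^ n) x) \<le> K * l ^ n" for n
    using assms by (auto simp: F1_def)
  then have "N ((A ^^ n) (g x)) \<le> (c * K) * l ^ n" for n
    using assms(3) by (simp add: commute_pow assms(1,2) mult.assoc mult_left_mono)
  then show ?thesis by (auto simp: F1_def)
qed

lemma F2_scale:
  assumes "\<And>x. A (g x) = g (A x)" "\<And>x. N (g x) = c * N x" "c \<ge> 0" "x \<in> F2"
  shows "g x \<in> F2"
proof -
  obtain K u where *: "(A ^^ n) (u n) = x" "m ^ n * N (u n) \<le> K" for n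
    using assms unfolding F2_def mem_Collect_eq by metis
  then have "(A ^^ n) (g (u n)) = g x" "m ^ n * N (g (u n)) \<le> c * K" for n
    using mult_left_mono[OF *(2) assms(3), of n]
    by (simp_all add: commute_pow assms(1,2) mult.left_commute)
  then show ?thesis unfolding F2_def by blast
qed

lemma zero_in_F: "0 \<in> F1" "0 \<in> F2"
proof -
  have "(A ^^ n) 0 = 0" for n
    by (rule linear_0[OF linear_pow])
  then have "N ((A ^^ n) 0) \<le> 0 * l ^ n" "(A ^^ n) 0 = 0 \<and> m ^ n * N 0 \<le> 0" for n
    by simp_all
  then show "0 \<in> F1" "0 \<in> F2"
    unfolding F1_def F2_def by blast+
qed

lemma F1_invariant: "A ` F1 \<subseteq> F1"
proof (rule image_subsetI)
  fix x assume "x \<in> F1"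
  then obtain K where K: "N ((A ^^ n) x) \<le> K * l ^ n" for n
    by (auto simp: F1_def)
  have "N ((A ^^ n) (A x)) \<le> (K * l) * l ^ n" for n
    using K[of "Suc n"] by (simp add: funpow_swap1 mult_ac)
  then show "A x \<in> F1" by (auto simp: F1_def)
qed

lemma F2_invariant: "A ` F2 \<subseteq> F2"
proof (rule image_subsetI)
  fix x assume "x \<in> F2"
  then obtain K where K: "\<exists>z. (A ^^ n) z = x \<and> m ^ n * N z \<le> K" for n
    unfolding F2_def by blast
  \<comment> \<open>For \<open>n = 0\<close> the only preimage is \<open>A x\<close> itself, which
    costs \<open>N (A x)\<close>. For \<open>n = k + 1\<close> a \<open>k\<close>-th preimage of
    \<open>x\<close> serves, at the price of one more factor \<open>m\<close>.\<close>
  have "\<exists>z. (A ^^ n) z = A x \<and> m ^ n * N z \<le> max (m * K) (N (A x))" for n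
  proof (cases n)
    case (Suc k)
    obtain z where z: "(A ^^ k) z = x" "m ^ k * N z \<le> K"
      using K by blast
    then have "m * (m ^ k * N z) \<le> m * K"
      using m_pos by (intro mult_left_mono) auto
    then show ?thesis
      using z Suc by (intro exI[of _ z]) (auto simp: mult.assoc)
  qed auto
  then show "A x \<in> F2" unfolding F2_def by blast
qed

lemma F1_contracting: "F1 \<subseteq> C"
proof
  fix x assume "x \<in> F1"
  then obtain K where K: "N ((A ^^ n) x) \<le> K * l ^ n" for n
    by (auto simp: F1_def)
  show "x \<in> C"
  proof (rule ccontr)
    assume "x \<notin> C"
    then have "x \<in> D" using cones_cover by blast
    then have "m ^ n * N x \<le> K * l ^ n" for n
      using expanding_pow[of x n] K[of n] by linarith
    then have "N x \<le> 0"
      using l_nonneg l_less_m by (intro geometric_comparison)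
    then show False using \<open>x \<notin> C\<close> N_le_0[of x] by auto
  qed
qed

lemma F2_expanding: "F2 \<subseteq> D"
proof
  fix x assume "x \<in> F2"
  then obtain K where K: "\<exists>z. (A ^^ n) z = x \<and> m ^ n * N z \<le> K" for n
    by (auto simp: F2_def)
  show "x \<in> D"
  proof (rule ccontr)
    assume "x \<notin> D"
    then have "x \<in> C" using cones_cover by blast
    \<comment> \<open>Since \<open>x\<close> is the last iterate of \<open>z\<close> and lies in
      \<open>C\<close>, the whole path from \<open>z\<close> contracts:
      \<open>N x \<le> l ^ n * N z\<close>, while \<open>N z\<close> is at most
      \<open>K / m ^ n\<close>.\<close>
    have "m ^ n * N x \<le> K * l ^ n" for n
    proof -
      obtain z where z: "(A ^^ n) z = x" "m ^ n * N z \<le> K"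
        using K by blast
      then have "m ^ n * N x \<le> m ^ n * (l ^ n * N z)"
        using contracting_pow[of n z] \<open>x \<in> C\<close> m_pos by (intro mult_left_mono) auto
      also have "\<dots> = l ^ n * (m ^ n * N z)" by simp
      also have "\<dots> \<le> l ^ n * K"
        using z l_nonneg by (intro mult_left_mono) auto
      finally show ?thesis by (simp add: mult.commute)
    qed
    then have "N x \<le> 0"
      using l_nonneg l_less_m by (intro geometric_comparison)
    then show False using \<open>x \<notin> D\<close> N_le_0[of x] by auto
  qed
qed

text \<open>The constant \<open>K\<close> of the growth bound disappears: \<open>A x\<close> lies in
  \<open>F1\<close>, hence in \<open>C\<close>, and one step of contraction applies.\<close>

lemma F1_bound: "x \<in> F1 \<Longrightarrow> N (A x) \<le> l * N x"
  using F1_invariant F1_contracting by (intro contract) auto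

lemma F1_Int_F2: "F1 \<inter> F2 = {0}"
proof -
  have "x = 0" if "x \<in> F1" "x \<in> F2" for x
    using that F1_invariant F1_contracting F2_expanding
    by (intro expanding_to_contracting_0) auto
  then show ?thesis using zero_in_F by auto
qed

text \<open>If the second coordinate of the iterate vanishes, the iterate is in \<open>C\<close>;
  pulling back puts \<open>(0, y)\<close> in \<open>C\<close>, which forces
  \<open>y = 0\<close>.\<close>

lemma pow_snd_surj: "\<exists>y. snd ((A ^^ n) (0, y)) = w"
proof -
  let ?h = "\<lambda>y. snd ((A ^^ n) (0, y))"
  have lin_h: "linear ?h"
    by (rule linearI)
      (simp_all flip: snd_add snd_scaleR linear_add[OF linear_pow] linear_scale[OF linear_pow])
  have "inj ?h"
  proof (subst linear_injective_0[OF lin_h], intro allI impI)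
    fix y assume "snd ((A ^^ n) (0, y)) = 0"
    then have "(A ^^ n) (0, y) \<in> C" by (simp add: contracting_cone_def)
    then have "(0, y) \<in> C" using contracting_pow by blast
    then show "y = 0" using r_pos by (simp add: contracting_cone_def mult_le_0_iff)
  qed
  with S2 lin_h have "surj ?h" by (intro linear_inj_imp_surj_finite_span)
  then obtain y where "w = ?h y" by (rule surjE)
  then show ?thesis by auto
qed

lemma span_prod_UNIV:
  obtains S :: "('a \<times> 'b) set" where "finite S" "span S = UNIV"
proof
  let ?S = "S1 \<times> {0} \<union> {0} \<times> S2"
  show "finite ?S" using S1 S2 by auto
  show "span ?S = UNIV"
    by (auto simp: span_Un real_vector.span_Times_sing1 real_vector.span_Times_sing2 S1 S2)
qed

lemma continuous_pow [continuous_intros]: "continuous_on X (A ^^ n)"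
proof -
  obtain S :: "('a \<times> 'b) set" where "finite S" "span S = UNIV"
    by (rule span_prod_UNIV)
  then show ?thesis
    by (intro linear_continuous_on bounded_linear_finite_span linear_pow)
qed

lemma fst_F1: "fst ` F1 = UNIV"
proof -
  have "e \<in> fst ` F1" for e
  proof -
    \<comment> \<open>The candidates \<open>y\<close> over \<open>e\<close> at time
      \<open>n\<close>. Backward invariance of \<open>C\<close> makes these sets nested, and at time
      0 the cone condition bounds \<open>y\<close> by \<open>norm e / r\<close>.\<close>
    let ?K = "\<lambda>n. {y. (A ^^ n) (e, y) \<in> C}"
    have closed: "closed (?K n)" for n
      unfolding contracting_cone_def mem_Collect_eq
      by (intro closed_Collect_le continuous_intros continuous_on_compose2[OF continuous_pow[of UNIV]]) auto
    have "norm y \<le> norm e / r" if "y \<in> ?K 0" for y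
      using that r_pos by (simp add: contracting_cone_def field_simps)
    then have "compact (?K 0)"
      by (intro compact_if_finite_span[OF S2] closed) (auto simp: bounded_iff)
    moreover have "?K n \<noteq> {}" for n
    proof -
      \<comment> \<open>This \<open>y\<close> cancels the second coordinate of the iterate of
        \<open>(e, 0)\<close>, which puts the iterate of \<open>(e, y)\<close> in
        \<open>C\<close>.\<close>
      obtain y where y: "snd ((A ^^ n) (0, y)) = - snd ((A ^^ n) (e, 0))"
        using pow_snd_surj by blast
      have "(A ^^ n) (e, y) = (A ^^ n) (e, 0) + (A ^^ n) (0, y)"
        by (simp flip: linear_add[OF linear_pow])
      then have "snd ((A ^^ n) (e, y)) = 0" using y by simp
      then have "(A ^^ n) (e, y) \<in> C" by (simp add: contracting_cone_def)
      then show ?thesis by blast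
    qed
    moreover have "?K (Suc n) \<subseteq> ?K n" for n
      using contracting_backward[of "(A ^^ n) (e, _)"] by auto
    ultimately have "\<exists>y. \<forall>n. y \<in> ?K n"
      by (intro nested_compact_inter closed)
    then obtain y where "(A ^^ n) (e, y) \<in> C" for n
      by blast
    then have "N ((A ^^ n) (e, y)) \<le> N (e, y) * l ^ n" for n
      using contracting_pow[of n "(e, y)" for n] by (simp add: mult.commute)
    then show ?thesis by (force simp: F1_def)
  qed
  then show ?thesis by blast
qed

lemma snd_F2: "snd ` F2 = UNIV"
proof -
  have "e \<in> snd ` F2" for e
  proof -
    \<comment> \<open>A point \<open>(w, e)\<close> of \<open>D\<close> has cone norm
      \<open>r * norm e\<close>, so expansion forces this bound on any preimage in \<open>D\<close>.
      Including it excludes nothing, makes \<open>Z n\<close> compact and its image closed, and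
      provides the constant required in \<open>F2\<close>.\<close>
    define Z where "Z n = D \<inter> {z. m ^ n * N z \<le> r * norm e}" for n
    define K where "K n = {w. (w, e) \<in> (A ^^ n) ` Z n}" for n
    obtain S :: "('a \<times> 'b) set" where S: "finite S" "span S = UNIV"
      by (rule span_prod_UNIV)
    have "compact (Z n)" for n
    proof (rule compact_if_finite_span[OF S])
      show "closed (Z n)"
        unfolding Z_def expanding_cone_def cone_norm_def
        by (intro closed_Int closed_Collect_le continuous_intros)
      have "norm z \<le> r * norm e / m ^ n + r * norm e / m ^ n / r" if "z \<in> Z n" for z
      proof -
        have "N z \<le> r * norm e / m ^ n"
          using that m_pos by (simp add: Z_def field_simps)
        then have "norm (fst z) \<le> r * norm e / m ^ n" "r * norm (snd z) \<le> r * norm e / m ^ n"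
          by (auto simp: cone_norm_def)
        moreover from this have "norm (snd z) \<le> r * norm e / m ^ n / r"
          using r_pos by (subst pos_le_divide_eq) (simp_all only: mult.commute)
        ultimately show ?thesis
          using norm_Pair_le[of "fst z" "snd z"] by simp
      qed
      then show "bounded (Z n)" unfolding bounded_iff by blast
    qed
    then have "closed ((A ^^ n) ` Z n)" for n
      by (intro compact_imp_closed compact_continuous_image continuous_pow)
    then have "closed ((\<lambda>w. (w, e)) -` ((A ^^ n) ` Z n))" for n
      by (intro closed_vimage continuous_intros)
    then have closed: "closed (K n)" for n
      by (simp add: K_def vimage_def)
    have KD: "(w, e) \<in> D" if "w \<in> K n" for w n
      using that expanding_pow by (auto simp: K_def Z_def)
    then have "norm w \<le> r * norm e" if "w \<in> K 0" for w
      using that by (fastforce simp: expanding_cone_def)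
    then have "compact (K 0)"
      by (intro compact_if_finite_span[OF S1] closed) (auto simp: bounded_iff)
    moreover have "w \<in> K n" if "(A ^^ n) z = (w, e)" "z \<in> D" for n z w
      using that expanding_pow[of z n] cone_norm_expanding[of "(w, e)" r]
      by (force simp: K_def Z_def image_iff)
    note KI = this
    have "K n \<noteq> {}" for n
    proof -
      obtain y where y: "snd ((A ^^ n) (0, y)) = e"
        using pow_snd_surj by blast
      then have "fst ((A ^^ n) (0, y)) \<in> K n"
        using r_pos by (intro KI[of _ "(0, y)"]) (auto simp: expanding_cone_def)
      then show ?thesis by auto
    qed
    moreover have "K (Suc n) \<subseteq> K n" for n
    proof
      fix w assume "w \<in> K (Suc n)"
      then obtain z where "(A ^^ Suc n) z = (w, e)" "z \<in> D"
        by (auto simp: K_def Z_def)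
      then show "w \<in> K n"
        using expanding_invariant by (intro KI[of _ "A z"]) (auto simp: funpow_swap1)
    qed
    ultimately have "\<exists>w. \<forall>n. w \<in> K n"
      by (intro nested_compact_inter closed)
    then obtain w where "w \<in> K n" for n
      by blast
    then have "(w, e) \<in> F2"
      by (force simp: K_def Z_def F2_def)
    then show ?thesis by force
  qed
  then show ?thesis by blast
qed

end

section \<open>Spectral bounds and the rates\<close>

lemma funpow_eigenvector:
  assumes "Vector_Spaces.linear s s T" "T p = s z p"
  shows "(T ^^ n) p = s (z ^ n) p"
proof (induction n)
  case 0
  interpret T: Vector_Spaces.linear s s T by (fact assms)
  show ?case by simp
next
  case (Suc n)
  interpret T: Vector_Spaces.linear s s T by (fact assms)
  show ?case using Suc assms(2) by (simp add: T.scale mult.commute)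
qed

lemma funpow_map_prod:
  fixes f :: "'a \<Rightarrow> 'a" and g :: "'b \<Rightarrow> 'b"
  shows "(map_prod f g ^^ n) p = ((f ^^ n) (fst p), (g ^^ n) (snd p))"
  by (induction n) (simp_all add: prod_eq_iff)

context
  fixes s :: "'k::real_or_complex \<Rightarrow> 'a::real_normed_vector \<times> 'b::real_normed_vector \<Rightarrow> 'a \<times> 'b"
    and A :: "'a \<times> 'b \<Rightarrow> 'a \<times> 'b" and F and r :: real and z
  assumes s: "\<forall>t x. s (of_real t) x = t *\<^sub>R x" and A: "linear A" and r: "r > 0"
    and F: "A ` F \<subseteq> F"
    and z: "z \<in> eigenvalues_on (complexify_scale s) (F \<times> F) (map_prod A A)"
begin

text \<open>A substitute for a norm on the complexification. It is homogeneous under complex scalars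
  only up to a factor 2, which growth rates do not see.\<close>

private definition M where "M p = cone_norm r (fst p) + cone_norm r (snd p)"

private lemma M_scale_le: "M (complexify_scale s w p) \<le> 2 * cmod w * M p"
proof -
  have tri: "cone_norm r (a *\<^sub>R x + b *\<^sub>R y) \<le> cmod w * cone_norm r x + cmod w * cone_norm r y"
    if "\<bar>a\<bar> \<le> cmod w" "\<bar>b\<bar> \<le> cmod w" for a b x y
    using cone_norm_triangle[OF r, of "a *\<^sub>R x" "b *\<^sub>R y"] that
      mult_right_mono[OF that(1) cone_norm_nonneg[of r x]]
      mult_right_mono[OF that(2) cone_norm_nonneg[of r y]]
    by (simp add: cone_norm_scaleR)
  from tri[of "Re w" "- Im w" "fst p" "snd p"] tri[of "Re w" "Im w" "snd p" "fst p"]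
  show ?thesis
    by (simp add: M_def complexify_scale_of_real[OF s] abs_Re_le_cmod abs_Im_le_cmod algebra_simps)
qed

private lemma eigenvector:
  obtains p where "fst p \<in> F" "snd p \<in> F" "0 < M p"
    "\<And>n. M (complexify_scale s (z ^ n) p) = cone_norm r ((A ^^ n) (fst p)) + cone_norm r ((A ^^ n) (snd p))"
proof -
  obtain p where p: "p \<in> F \<times> F" "p \<noteq> 0" "map_prod A A p = complexify_scale s z p"
    using z unfolding eigenvalues_on_def by blast
  have "M p \<noteq> 0"
    using p(2) r cone_norm_nonneg[of r] unfolding M_def
    by (metis add_nonneg_eq_0_iff cone_norm_eq_0 prod_eqI fst_zero snd_zero)
  then have "0 < M p"
    using add_nonneg_nonneg[OF cone_norm_nonneg[of r "fst p"] cone_norm_nonneg[of r "snd p"]]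
    by (simp add: M_def)
  moreover have "complexify_scale s (z ^ n) p = ((A ^^ n) (fst p), (A ^^ n) (snd p))" for n
    using funpow_eigenvector[OF linear_complexify[OF s A] p(3), of n]
    by (simp add: funpow_map_prod)
  ultimately show ?thesis
    using that[of p] p(1) by (auto simp: M_def mem_Times_iff)
qed

private lemma pow_in_F: "x \<in> F \<Longrightarrow> (A ^^ n) x \<in> F"
  using F by (induction n) auto

text \<open>On an eigenvector \<open>p\<close> of the complexification, \<open>M\<close> of the
  iterates grows like \<open>cmod z ^ n\<close> up to a factor 2, but at most like
  \<open>l ^ n\<close> because both components of \<open>p\<close> lie in \<open>F\<close>.\<close>

lemma cmod_eigenvalue_le:
  assumes "0 \<le> l" and l: "\<And>x. x \<in> F \<Longrightarrow> cone_norm r (A x) \<le> l * cone_norm r x"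
  shows "cmod z \<le> l"
proof (rule ccontr)
  assume "\<not> cmod z \<le> l"
  then have zl: "l < cmod z" "z \<noteq> 0" using assms(1) by auto
  obtain p where p: "fst p \<in> F" "snd p \<in> F" "0 < M p"
    "\<And>n. M (complexify_scale s (z ^ n) p) = cone_norm r ((A ^^ n) (fst p)) + cone_norm r ((A ^^ n) (snd p))"
    by (rule eigenvector) blast
  interpret vector_space "complexify_scale s" by (rule vector_space_complexify[OF s])
  have pow: "cone_norm r ((A ^^ n) x) \<le> l ^ n * cone_norm r x" if "x \<in> F" for x n
  proof (induction n)
    case (Suc n)
    then show ?case
      using l[OF pow_in_F[OF that, of n]] mult_left_mono[OF Suc assms(1)] by (simp add: mult.assoc)
  qed simp
  have "cmod z ^ n * M p \<le> (2 * M p) * l ^ n" for n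
  proof -
    \<comment> \<open>Only an upper bound is known for scaling by a complex number; applied to the
      inverse of \<open>z ^ n\<close> it becomes the lower bound.\<close>
    have "M p = M (complexify_scale s (inverse (z ^ n)) (complexify_scale s (z ^ n) p))"
      using zl by simp
    also have "\<dots> \<le> 2 * cmod (inverse (z ^ n)) * M (complexify_scale s (z ^ n) p)"
      by (rule M_scale_le)
    also have "cmod (inverse (z ^ n)) = inverse (cmod z ^ n)"
      by (simp add: norm_inverse norm_power)
    finally have "cmod z ^ n * M p \<le> 2 * M (complexify_scale s (z ^ n) p)"
      using zl by (simp add: field_simps)
    also have "M (complexify_scale s (z ^ n) p) \<le> l ^ n * M p"
      using pow[OF p(1), of n] pow[OF p(2), of n] unfolding p(4) by (simp add: M_def distrib_left)
    finally show ?thesis by (simp add: mult_ac)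
  qed
  then have "M p \<le> 0"
    using assms(1) zl(1) by (intro geometric_comparison)
  then show False using p(3) by simp
qed

lemma cmod_eigenvalue_ge:
  assumes "0 \<le> R" and R: "\<And>x. x \<in> F \<Longrightarrow> R * cone_norm r x \<le> cone_norm r (A x)"
  shows "R \<le> cmod z"
proof (rule ccontr)
  assume "\<not> R \<le> cmod z"
  then have zR: "cmod z < R" by simp
  obtain p where p: "fst p \<in> F" "snd p \<in> F" "0 < M p"
    "\<And>n. M (complexify_scale s (z ^ n) p) = cone_norm r ((A ^^ n) (fst p)) + cone_norm r ((A ^^ n) (snd p))"
    by (rule eigenvector) blast
  have pow: "R ^ n * cone_norm r x \<le> cone_norm r ((A ^^ n) x)" if "x \<in> F" for x n
  proof (induction n)
    case (Suc n)
    then show ?case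
      using R[OF pow_in_F[OF that, of n]] mult_left_mono[OF Suc assms(1)] by (simp add: mult.assoc)
  qed simp
  have "R ^ n * M p \<le> (2 * M p) * cmod z ^ n" for n
  proof -
    have "R ^ n * M p \<le> M (complexify_scale s (z ^ n) p)"
      using pow[OF p(1), of n] pow[OF p(2), of n] unfolding p(4) by (simp add: M_def distrib_left)
    also have "\<dots> \<le> 2 * cmod (z ^ n) * M p"
      by (rule M_scale_le)
    finally show ?thesis by (simp add: norm_power mult_ac)
  qed
  then have "M p \<le> 0"
    using zR by (intro geometric_comparison) auto
  then show False using p(3) by simp
qed

end

section \<open>Restriction of scalars to the reals and the product space\<close>

lemma scalars_real_span:
  "\<exists>j :: 'k::real_or_complex. \<forall>c. \<exists>a b. c = of_real a + of_real b * j"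
proof (cases "range (to_complex :: 'k \<Rightarrow> complex) = \<real>")
  case True
  have "c = of_real (Re (to_complex c)) + of_real 0 * 0" for c :: 'k
  proof (rule injD[OF inj_to_complex])
    have "to_complex c \<in> \<real>" using True by blast
    then show "to_complex c = to_complex (of_real (Re (to_complex c)) + of_real 0 * 0 :: 'k)"
      by (simp add: to_complex_of_real of_real_Re)
  qed
  then show ?thesis by blast
next
  case False
  then obtain j :: 'k where j: "to_complex j = \<i>"
    using range_to_complex[where 'k = 'k] by (metis UNIV_I imageE)
  from scalar_decomposition[OF this] show ?thesis by blast
qed

text \<open>A basis over the scalar field together with its multiples by \<open>j\<close> spans over
  the reals. This supplies the spanning sets on which the compactness arguments rest.\<close>

lemma fd_normed_space_real_span:
  fixes s :: "'k::real_or_complex \<Rightarrow> 'v::real_normed_vector \<Rightarrow> 'v"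
  assumes "fd_normed_space s"
  obtains S :: "'v set" where "finite S" "span S = UNIV"
proof -
  obtain B where "finite_dimensional_vector_space s B"
    and s: "s (of_real t) x = t *\<^sub>R x" for t x
    using assms unfolding fd_normed_space_def by blast
  then interpret V: finite_dimensional_vector_space s B by simp
  obtain j :: 'k where j: "\<exists>a b. c = of_real a + of_real b * j" for c :: 'k
    using scalars_real_span by blast
  have mem: "s c x \<in> span (B \<union> s j ` B)" if "x \<in> B" for c x
  proof -
    obtain a b where "c = of_real a + of_real b * j" using j by blast
    then have "s c x = a *\<^sub>R x + b *\<^sub>R s j x"
      by (simp add: V.scale_left_distrib s flip: V.scale_scale)
    moreover have "x \<in> span (B \<union> s j ` B)" "s j x \<in> span (B \<union> s j ` B)"
      using that by (auto intro: span_base)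
    ultimately show ?thesis
      by (simp add: span_add span_scale)
  qed
  have "v \<in> span (B \<union> s j ` B)" for v
  proof -
    have "v \<in> range (\<lambda>u. \<Sum>w\<in>B. s (u w) w)"
      using V.span_finite[OF V.finite_Basis] V.span_Basis by auto
    then show ?thesis
      using mem by (auto intro!: span_sum)
  qed
  then show ?thesis
    using that[of "B \<union> s j ` B"] V.finite_Basis by auto
qed

lemma prod_scale_vector_space:
  assumes "finite_dimensional_vector_space s1 B1" "finite_dimensional_vector_space s2 B2"
  shows "\<exists>B. finite_dimensional_vector_space (prod_scale s1 s2) B"
    and "Vector_Spaces.linear (prod_scale s1 s2) s1 fst"
    and "Vector_Spaces.linear (prod_scale s1 s2) s2 snd"
    and "vector_space.dim (prod_scale s1 s2) UNIV = vector_space.dim s1 UNIV + vector_space.dim s2 UNIV"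
proof -
  interpret V1: finite_dimensional_vector_space s1 B1 by fact
  interpret V2: finite_dimensional_vector_space s2 B2 by fact
  interpret E: finite_dimensional_vector_space_prod s1 s2 B1 B2 by unfold_locales
  have eq: "E.scale = prod_scale s1 s2"
    by (simp add: fun_eq_iff E.scale_def prod_scale_def)
  show "\<exists>B. finite_dimensional_vector_space (prod_scale s1 s2) B"
    using E.p.finite_dimensional_vector_space_axioms unfolding eq by blast
  show "Vector_Spaces.linear (prod_scale s1 s2) s1 fst" "Vector_Spaces.linear (prod_scale s1 s2) s2 snd"
    using E.linear_fst E.linear_snd unfolding eq by blast+
  show "vector_space.dim (prod_scale s1 s2) UNIV = vector_space.dim s1 UNIV + vector_space.dim s2 UNIV"
    using E.dim_Times[OF V1.subspace_UNIV V2.subspace_UNIV] unfolding eq by simp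
qed

text \<open>For each nonzero \<open>x\<close> with \<open>A x\<close> in the cone, the quotient of
  norms is a lower bound for all admissible constants, hence also for their infimum.\<close>

lemma contraction_rate_attained:
  assumes "contraction_rate r A < \<infinity>" "r > 0" "A 0 = 0"
  obtains l where "contraction_rate r A = ereal l" "0 \<le> l"
    "\<And>x. A x \<in> contracting_cone r \<Longrightarrow> cone_norm r (A x) \<le> l * cone_norm r x"
proof -
  have "0 \<le> contraction_rate r A"
    unfolding contraction_rate_def by (intro Inf_greatest) auto
  then obtain l where l: "contraction_rate r A = ereal l" "0 \<le> l"
    using assms(1) by (cases "contraction_rate r A") auto
  have "cone_norm r (A x) \<le> l * cone_norm r x" if x: "A x \<in> contracting_cone r" for x
  proof (cases "x = 0")
    case False
    then have pos: "cone_norm r x > 0"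
      using cone_norm_nonneg[of r x] assms(2) by (simp add: less_le)
    have "ereal (cone_norm r (A x) / cone_norm r x) \<le> contraction_rate r A"
      unfolding contraction_rate_def using x pos
      by (intro Inf_greatest) (auto simp: pos_divide_le_eq simp del: split_paired_All)
    then show ?thesis
      using pos by (simp add: l pos_divide_le_eq)
  qed (simp add: assms(3))
  with l show ?thesis by (rule that)
qed

text \<open>Upper bounds are tested on every admissible real \<open>R\<close>, so finite and
  infinite rates are treated alike.\<close>

lemma le_expansion_rate:
  assumes "\<And>R. \<lbrakk>0 \<le> R; \<And>x. x \<in> expanding_cone r \<Longrightarrow> R * cone_norm r x \<le> cone_norm r (A x)\<rbrakk>
    \<Longrightarrow> ereal R \<le> u"
  shows "expansion_rate r A \<le> u"
  unfolding expansion_rate_def by (intro Sup_least) (use assms in blast)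

lemma less_expansion_rateE:
  assumes "ereal l < expansion_rate r A"
  obtains m where "l < m" "ereal m \<le> expansion_rate r A"
    "\<And>x. x \<in> expanding_cone r \<Longrightarrow> m * cone_norm r x \<le> cone_norm r (A x)"
proof -
  obtain m where m: "l < m" "0 \<le> m"
      "\<forall>x\<in>expanding_cone r. m * cone_norm r x \<le> cone_norm r (A x)"
    using assms unfolding expansion_rate_def less_Sup_iff by auto
  have "ereal m \<le> expansion_rate r A"
    unfolding expansion_rate_def using m by (intro Sup_upper) auto
  with m show ?thesis using that[of m] by blast
qed

theorem theorem3p3:
  fixes s1 :: "'k::real_or_complex \<Rightarrow> 'a::real_normed_vector \<Rightarrow> 'a"
    and s2 :: "'k \<Rightarrow> 'b::real_normed_vector \<Rightarrow> 'b"
    and A :: "'a \<times> 'b \<Rightarrow> 'a \<times> 'b"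
    and r :: real
  assumes "fd_normed_space s1" and "fd_normed_space s2"
    and "r > 0"
    and "Vector_Spaces.linear (prod_scale s1 s2) (prod_scale s1 s2) A"
    and "dominating r A"
  shows "\<exists>F1 F2.
    spectral_decomposition (prod_scale s1 s2) r A F1 F2 \<and>
    (\<forall>G1 G2. spectral_decomposition (prod_scale s1 s2) r A G1 G2 \<longrightarrow> G1 = F1 \<and> G2 = F2) \<and>
    vector_space.dim (prod_scale s1 s2) F1 = vector_space.dim s1 (UNIV :: 'a set) \<and>
    vector_space.dim (prod_scale s1 s2) F2 = vector_space.dim s2 (UNIV :: 'b set) \<and>
    F1 \<subseteq> contracting_cone r \<and> F2 \<subseteq> expanding_cone r \<and>
    cone_onorm_on r F1 A \<le> contraction_rate r A \<and>
    bij_betw A F2 F2 \<and>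
    cone_onorm_on r F2 (inv_into F2 A) \<le> inverse (expansion_rate r A)"
proof -
  let ?s = "prod_scale s1 s2"
  obtain B1 B2 where B: "finite_dimensional_vector_space s1 B1" "finite_dimensional_vector_space s2 B2"
    and s12: "\<forall>t x. s1 (of_real t) x = t *\<^sub>R x" "\<forall>t x. s2 (of_real t) x = t *\<^sub>R x"
      "\<forall>c x. norm (s1 c x) = norm c * norm x" "\<forall>c x. norm (s2 c x) = norm c * norm x"
    using assms(1,2) unfolding fd_normed_space_def by blast
  obtain Bp where "finite_dimensional_vector_space ?s Bp"
    using prod_scale_vector_space(1)[OF B] by blast
  then interpret P: finite_dimensional_vector_space ?s Bp .
  interpret V1: finite_dimensional_vector_space s1 B1 by (fact B)
  interpret V2: finite_dimensional_vector_space s2 B2 by (fact B)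
  interpret P1: finite_dimensional_vector_space_pair_1 ?s Bp s1 by unfold_locales
  interpret P2: finite_dimensional_vector_space_pair_1 ?s Bp s2 by unfold_locales
  interpret PP: finite_dimensional_vector_space_pair_1 ?s Bp ?s by unfold_locales
  interpret A: Vector_Spaces.linear ?s ?s A by (fact assms(4))
  have s: "\<forall>t x. ?s (of_real t) x = t *\<^sub>R x"
    using s12 by (simp add: prod_scale_def prod_eq_iff)
  have linA: "linear A"
    using A.add A.scale s by (metis linearI)
  have subspace_real: "subspace G" if "P.subspace G" for G
    using that s P.subspace_0 P.subspace_add P.subspace_scale by (metis subspaceI)
  obtain S1 :: "'a set" where S1: "finite S1" "span S1 = UNIV"
    using fd_normed_space_real_span[OF assms(1)] .
  obtain S2 :: "'b set" where S2: "finite S2" "span S2 = UNIV"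
    using fd_normed_space_real_span[OF assms(2)] .
  have dom: "contraction_rate r A < expansion_rate r A"
    using assms(5) by (simp add: dominating_def)
  then have "contraction_rate r A < \<infinity>"
    by (metis ereal_infty_less(1) ereal_less_PInfty less_le_trans linorder_not_less top_greatest top_ereal_def)
  then obtain l where l: "contraction_rate r A = ereal l" "0 \<le> l"
    "\<And>x. A x \<in> contracting_cone r \<Longrightarrow> cone_norm r (A x) \<le> l * cone_norm r x"
    using contraction_rate_attained[of r A] assms(3) A.zero by blast
  obtain m where m: "l < m" "ereal m \<le> expansion_rate r A"
    "\<And>x. x \<in> expanding_cone r \<Longrightarrow> m * cone_norm r x \<le> cone_norm r (A x)"
    using less_expansion_rateE[of l r A] dom unfolding l(1) by blast
  interpret K: cone_splitting A S1 S2 r l m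
    by (rule cone_splitting.intro[OF linA S1 S2 assms(3) l(2) m(1) l(3) m(3)])

  have scale_norm: "cone_norm r (?s c x) = norm c * cone_norm r x" for c x
    using s12 by (intro cone_norm_scale) (simp_all add: prod_scale_def)
  have sub: "P.subspace K.F1" "P.subspace K.F2"
    unfolding P.subspace_def
    using K.zero_in_F K.F1_add K.F2_add K.F1_scale[OF A.scale scale_norm] K.F2_scale[OF A.scale scale_norm]
    by auto
  have span: "P.span K.F1 = K.F1" "P.span K.F2 = K.F2"
    using sub by (simp_all only: P.span_eq_iff)
  have inv: "A ` K.F1 \<subseteq> K.F1" "A ` K.F2 \<subseteq> K.F2"
    by (rule K.F1_invariant K.F2_invariant)+
  have inj_on_subspace: "inj_on f G"
    if "P.subspace G" "Vector_Spaces.linear ?s u f" "\<And>x. \<lbrakk>x \<in> G; f x = 0\<rbrakk> \<Longrightarrow> x = 0"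
    for G f and u :: "'k \<Rightarrow> 'c::ab_group_add \<Rightarrow> 'c"
  proof (rule inj_onI)
    interpret f: Vector_Spaces.linear ?s u f by fact
    fix x y assume "x \<in> G" "y \<in> G" "f x = f y"
    then show "x = y"
      using that(1) that(3)[of "x - y"] by (simp add: f.diff P.subspace_diff)
  qed
  have "inj_on fst K.F1"
  proof (rule inj_on_subspace[OF sub(1) prod_scale_vector_space(2)[OF B]])
    fix x assume "x \<in> K.F1" "fst x = 0"
    then show "x = 0"
      using K.F1_contracting assms(3) by (force simp: contracting_cone_def prod_eq_iff mult_le_0_iff)
  qed
  then have dim1: "P.dim K.F1 = V1.dim UNIV"
    using P1.dim_image_eq[OF prod_scale_vector_space(2)[OF B], of K.F1] K.fst_F1
    by (simp add: span)
  have "inj_on snd K.F2"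
  proof (rule inj_on_subspace[OF sub(2) prod_scale_vector_space(3)[OF B]])
    fix x assume "x \<in> K.F2" "snd x = 0"
    then show "x = 0"
      using K.F2_expanding by (force simp: expanding_cone_def prod_eq_iff)
  qed
  then have dim2: "P.dim K.F2 = V2.dim UNIV"
    using P2.dim_image_eq[OF prod_scale_vector_space(3)[OF B], of K.F2] K.snd_F2
    by (simp add: span)
  \<comment> \<open>The projections identify \<open>F1\<close> and \<open>F2\<close> with the two
    factors, so their dimensions add up to that of the whole space.\<close>
  have "P.dim {x + y | x y. x \<in> K.F1 \<and> y \<in> K.F2} = P.dim UNIV"
    using P.dim_sums_Int[OF sub] dim1 dim2 prod_scale_vector_space(4)[OF B]
    by (simp add: K.F1_Int_F2)
  then have sum: "{x + y | x y. x \<in> K.F1 \<and> y \<in> K.F2} = UNIV"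
    using P.subspace_dim_equal[OF P.subspace_sums[OF sub] P.subspace_UNIV] by simp

  \<comment> \<open>A kernel vector in \<open>F2\<close> would lie in the expanding cone with image
    0 in the contracting one. Injectivity and invariance then give surjectivity by
    dimension.\<close>
  have inj_A: "inj_on A K.F2"
  proof (rule inj_on_subspace[OF sub(2) assms(4)])
    fix x assume "x \<in> K.F2" "A x = 0"
    then show "x = 0"
      using K.F2_expanding by (intro K.expanding_to_contracting_0) auto
  qed
  then have "P.dim (A ` K.F2) = P.dim K.F2"
    using PP.dim_image_eq[OF assms(4), of K.F2] by (simp add: span)
  then have "A ` K.F2 = K.F2"
    using P.subspace_dim_equal[OF A.subspace_image[OF sub(2)] sub(2) inv(2)] by simp
  with inj_A have bij: "bij_betw A K.F2 K.F2"
    by (simp add: bij_betw_def)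

  let ?eig = "\<lambda>G. eigenvalues_on (complexify_scale ?s) (G \<times> G) (map_prod A A)"
  have spectrum: "cmod ` spectrum_on ?s G A = cmod ` ?eig G" if "P.subspace G" for G
    using s assms(4) that by (rule cmod_spectrum_on)
  have spec_eig: "\<exists>z'\<in>?eig G. cmod z = cmod z'"
    if "P.subspace G" "z \<in> spectrum_on ?s G A" for G z
    using imageI[OF that(2), of cmod] unfolding spectrum[OF that(1)] by (simp add: image_iff)
  have eig_spec: "\<exists>z'\<in>spectrum_on ?s G A. cmod z = cmod z'"
    if "P.subspace G" "z \<in> ?eig G" for G z
    using imageI[OF that(2), of cmod] unfolding spectrum[OF that(1), symmetric] by (simp add: image_iff)
  have eig1: "cmod z \<le> l" if "z \<in> ?eig K.F1" for z
    using s linA assms(3) inv(1) that l(2) K.F1_bound by (rule cmod_eigenvalue_le)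
  \<comment> \<open>Stated for every admissible \<open>R\<close>: letting \<open>R\<close> vary
    yields the bound by the full expansion rate, and \<open>R = m\<close> is the case for
    uniqueness. \<open>F2\<close> was built from \<open>m\<close>, but only its position in the cone
    matters here.\<close>
  have eig2: "R \<le> cmod z" if "z \<in> ?eig K.F2" "0 \<le> R"
    "\<And>x. x \<in> expanding_cone r \<Longrightarrow> R * cone_norm r x \<le> cone_norm r (A x)" for z R
    using s linA assms(3) inv(2) that(1,2)
  proof (rule cmod_eigenvalue_ge)
    show "R * cone_norm r x \<le> cone_norm r (A x)" if "x \<in> K.F2" for x
      using that K.F2_expanding \<open>\<And>x. x \<in> expanding_cone r \<Longrightarrow> R * cone_norm r x \<le> cone_norm r (A x)\<close>
      by blast
  qed
  have "ereal (cmod z) \<le> contraction_rate r A" if "z \<in> spectrum_on ?s K.F1 A" for z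
  proof -
    from spec_eig[OF sub(1) that] obtain z' where "cmod z = cmod z'" "z' \<in> ?eig K.F1"
      by blast
    then show ?thesis using eig1 l(1) by simp
  qed
  moreover have "\<not> ereal (cmod z) < expansion_rate r A" if "z \<in> spectrum_on ?s K.F2 A" for z
  proof -
    from spec_eig[OF sub(2) that] obtain z' where "cmod z = cmod z'" "z' \<in> ?eig K.F2"
      by blast
    then show ?thesis
      unfolding not_less using eig2 by (intro le_expansion_rate) (simp del: split_paired_All)
  qed
  ultimately have decomp: "spectral_decomposition ?s r A K.F1 K.F2"
    using sub sum inv K.F1_Int_F2
    unfolding spectral_decomposition_def invariant_decomposition_def by blast

  have unique: "G1 = K.F1 \<and> G2 = K.F2" if "spectral_decomposition ?s r A G1 G2" for G1 G2
  proof -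
    have G: "P.subspace G1" "P.subspace G2" "{x + y | x y. x \<in> G1 \<and> y \<in> G2} = UNIV"
        "A ` G1 \<subseteq> G1" "A ` G2 \<subseteq> G2"
      and spec1: "\<And>z. z \<in> spectrum_on ?s G1 A \<Longrightarrow> ereal (cmod z) \<le> contraction_rate r A"
      and spec2: "\<And>z. z \<in> spectrum_on ?s G2 A \<Longrightarrow> \<not> ereal (cmod z) < expansion_rate r A"
      using that unfolding spectral_decomposition_def invariant_decomposition_def by blast+
    have eigG1: "cmod z \<le> l" if "z \<in> ?eig G1" for z
    proof -
      from eig_spec[OF G(1) that] obtain z' where "cmod z = cmod z'" "z' \<in> spectrum_on ?s G1 A"
        by blast
      then show ?thesis using spec1[of z'] l(1) by simp
    qed
    have eigG2: "m \<le> cmod z" if "z \<in> ?eig G2" for z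
    proof -
      from eig_spec[OF G(2) that] obtain z' where "cmod z = cmod z'" "z' \<in> spectrum_on ?s G2 A"
        by blast
      then have "ereal m \<le> ereal (cmod z)" using spec2[of z'] order_trans[OF m(2)] by (simp only: not_less)
      then show ?thesis by simp
    qed
    obtain Sp :: "('a \<times> 'b) set" where Sp: "finite Sp" "span Sp = UNIV"
      by (rule K.span_prod_UNIV)
    \<comment> \<open>Without a common eigenvalue of \<open>G\<close> and \<open>F\<close>, vectors
      of \<open>G\<close> have no component in \<open>F\<close> along \<open>F'\<close>. It is
      applied to \<open>G1\<close> with \<open>F2\<close> and to \<open>G2\<close> with
      \<open>F1\<close>.\<close>
    have "f = 0"
      if "\<And>z. \<lbrakk>z \<in> ?eig G; z \<in> ?eig F\<rbrakk> \<Longrightarrow> False" "P.subspace G" "P.subspace F" "P.subspace F'"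
        "A ` G \<subseteq> G" "A ` F \<subseteq> F" "A ` F' \<subseteq> F'" "F \<inter> F' = {0}" "f + f' \<in> G" "f \<in> F" "f' \<in> F'"
      for G F F' f f'
      using common_eigenvalue_of_sum[OF s linA Sp, of G F F' f f'] that subspace_real by blast
    note zero = this
    have "G1 \<subseteq> K.F1"
    proof
      fix x assume "x \<in> G1"
      obtain f1 f2 where f: "x = f1 + f2" "f1 \<in> K.F1" "f2 \<in> K.F2"
        using sum by blast
      have "f2 = 0"
      proof (rule zero[OF _ G(1) sub(2,1) G(4) inv(2,1)])
        show False if "z \<in> ?eig G1" "z \<in> ?eig K.F2" for z
          using eigG1[OF that(1)] eig2[OF that(2) _ m(3)] K.m_pos m(1) by simp
        show "K.F2 \<inter> K.F1 = {0}"
          using K.F1_Int_F2 by blast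
        show "f2 + f1 \<in> G1"
          using f \<open>x \<in> G1\<close> by (simp add: add.commute)
      qed (use f in auto)
      then show "x \<in> K.F1" using f by simp
    qed
    moreover have "G2 \<subseteq> K.F2"
    proof
      fix x assume "x \<in> G2"
      obtain f1 f2 where f: "x = f1 + f2" "f1 \<in> K.F1" "f2 \<in> K.F2"
        using sum by blast
      have "f1 = 0"
      proof (rule zero[OF _ G(2) sub G(5) inv K.F1_Int_F2])
        show False if "z \<in> ?eig G2" "z \<in> ?eig K.F1" for z
          using eigG2[OF that(1)] eig1[OF that(2)] m(1) by simp
        show "f1 + f2 \<in> G2"
          using f \<open>x \<in> G2\<close> by simp
      qed (use f in auto)
      then show "x \<in> K.F2" using f by simp
    qed
    ultimately have sub_G: "G1 \<subseteq> K.F1" "G2 \<subseteq> K.F2" .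
    \<comment> \<open>The inclusions become equalities because \<open>G1\<close> and
      \<open>G2\<close> also span: the component of \<open>x\<close> in \<open>G2\<close> lies in
      \<open>F1\<close> as well as in \<open>F2\<close>.\<close>
    have "x \<in> G1" if "x \<in> K.F1" for x
    proof -
      obtain g1 g2 where g: "x = g1 + g2" "g1 \<in> G1" "g2 \<in> G2"
        using G(3) by blast
      then have "x - g1 \<in> K.F1"
        using that sub_G(1) by (intro P.subspace_diff[OF sub(1)]) auto
      then have "g2 \<in> K.F1"
        using g by simp
      then have "g2 = 0"
        using g sub_G(2) K.F1_Int_F2 by auto
      then show ?thesis using g by simp
    qed
    moreover have "x \<in> G2" if "x \<in> K.F2" for x
    proof -
      obtain g1 g2 where g: "x = g1 + g2" "g1 \<in> G1" "g2 \<in> G2"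
        using G(3) by blast
      then have "x - g2 \<in> K.F2"
        using that sub_G(2) by (intro P.subspace_diff[OF sub(2)]) auto
      then have "g1 \<in> K.F2"
        using g by simp
      then have "g1 = 0"
        using g sub_G(1) K.F1_Int_F2 by auto
      then show ?thesis using g by simp
    qed
    ultimately show ?thesis using sub_G by blast
  qed

  have "cone_onorm_on r K.F1 A \<le> contraction_rate r A"
    unfolding cone_onorm_on_def
  proof (rule SUP_least)
    fix x assume "x \<in> K.F1"
    then show "ereal (cone_norm r (A x) / cone_norm r x) \<le> contraction_rate r A"
      using K.F1_bound[of x] cone_norm_nonneg[of r x] l(1,2)
      by (cases "cone_norm r x = 0") (simp_all add: pos_divide_le_eq less_le)
  qed
  moreover have "cone_onorm_on r K.F2 (inv_into K.F2 A) \<le> inverse (expansion_rate r A)"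
    unfolding cone_onorm_on_def
  proof (rule SUP_least)
    fix x assume "x \<in> K.F2"
    define y where "y = inv_into K.F2 A x"
    have y: "y \<in> K.F2" "A y = x"
      using bij \<open>x \<in> K.F2\<close> unfolding y_def bij_betw_def
      by (auto intro: inv_into_into f_inv_into_f)
    have rate_pos: "0 < expansion_rate r A"
      using m(2) K.m_pos by (metis ereal_less(2) less_le_trans)
    show "ereal (cone_norm r (inv_into K.F2 A x) / cone_norm r x) \<le> inverse (expansion_rate r A)"
      unfolding y_def[symmetric]
    proof (cases "x = 0")
      case False
      then have pos: "0 < cone_norm r x" "0 < cone_norm r y"
        using False y(2) A.zero K.N_le_0[of x] K.N_le_0[of y] by (auto simp flip: not_le)
      \<comment> \<open>As \<open>y\<close> lies in the expanding cone, every admissible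
        \<open>R\<close> is at most this quotient. The rate is therefore finite as soon as
        \<open>F2\<close> has a nonzero vector; if \<open>F2 = {0}\<close>, only the term for
        \<open>x = 0\<close> remains.\<close>
      have "expansion_rate r A \<le> ereal (cone_norm r x / cone_norm r y)"
      proof (rule le_expansion_rate)
        fix R assume "\<And>x. x \<in> expanding_cone r \<Longrightarrow> R * cone_norm r x \<le> cone_norm r (A x)"
        from this[of y] show "ereal R \<le> ereal (cone_norm r x / cone_norm r y)"
          using y pos K.F2_expanding by (auto simp: pos_le_divide_eq)
      qed
      then have "inverse (ereal (cone_norm r x / cone_norm r y)) \<le> inverse (expansion_rate r A)"
        using rate_pos by (intro ereal_inverse_antimono) auto
      then show "ereal (cone_norm r y / cone_norm r x) \<le> inverse (expansion_rate r A)"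
        using pos by simp
    qed (use rate_pos in \<open>simp add: zero_ereal_def[symmetric] ereal_inverse_nonneg_iff less_imp_le\<close>)
  qed
  ultimately show ?thesis
    using decomp unique dim1 dim2 K.F1_contracting K.F2_expanding bij by blast
qed

end
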